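(* Let $\boldsymbol{\tau} = (\tau_n : \mathcal{A}_{n+1}^* \to \mathcal{A}_n^* )_{n \ge 0}$ be a primitive, proper and recognizable directive sequence and $\mu$ an ergodic invariant probability measure of $(X_{\boldsymbol{\tau}}, S)$. Assume that $\boldsymbol{\tau}$ is clean with respect to $\mu$, with associated set of letters $\mathcal{A}_\mu$. Suppose that: (i) there exists $K > 0$ such that $|\tau_{[0,n)}| / \langle \tau_{[0,n)} \rangle \le K$ for all large enough $n$; and (ii) there exist $\delta > 0$ and, for all large enough $n$, a nonempty word $u_n \in \mathcal{A}_0^*$ and indices $c_n, d_n$ with $0 \le c_n < d_n \le \min_{a \in \mathcal{A}_\mu} |\tau_{[0,n)}(a)|$ which satisfy $|u_n| \ge \delta \min_{a \in \mathcal{A}_\mu} |\tau_{[0,n)}(a)|$ and $$\tau_{[0,n)}(a)_{[c_n, d_n)} = u_n \quad \text{for all } a \in \mathcal{A}_\mu .$$ If $\lambda = \exp(2\pi i \alpha)$ is a measurable eigenvalue of $(X_{\boldsymbol{\tau}}, S)$ with respect to $\mu$, then $$\lim_{n \to +\infty} \operatorname{dist}\big(\alpha h_n(a), \mathbb{Z}\big) = 0 \quad \text{for all } a \in \mathcal{A}_\mu,$$ where $h_n(a) = |\tau_{[0,n)}(a)|$.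
   Context: A directive sequence is a sequence of nonerasing morphisms $\tau_n : \mathcal{A}_{n+1}^* \to \mathcal{A}_n^*$ between free monoids on finite alphabets. $\tau_{[n,N)} = \tau_n \circ \cdots \circ \tau_{N-1}$ (identity if $n=N$). For a morphism $\tau:\mathcal{A}^*\to\mathcal{B}^*$, $\langle \tau \rangle = \min_{a\in\mathcal{A}} |\tau(a)|$ and $|\tau| = \max_{a\in\mathcal{A}} |\tau(a)|$. For a word $w = w_0 w_1 \cdots$, $w_{[c,d)} = w_c \cdots w_{d-1}$. $X_{\boldsymbol{\tau}}^{(n)}$ is the set of $x \in \mathcal{A}_n^{\mathbb{Z}}$ all of whose finite factors occur in some $\tau_{[n,N)}(a)$, $N > n$, $a \in \mathcal{A}_N$; $X_{\boldsymbol{\tau}} = X_{\boldsymbol{\tau}}^{(0)}$; $S$ is the shift. Primitive: for every $n$ there is $N > n$ such that for all $a \in \mathcal{A}_N$ the word $\tau_{[n,N)}(a)$ contains all letters of $\mathcal{A}_n$. Proper: for every $n$ there are letters $p_n, s_n \in \mathcal{A}_n$ such that $\tau_n(a)$ starts with $p_n$ and ends with $s_n$ for all $a \in \mathcal{A}_{n+1}$. Recognizable: for every $n$ and every $y \in \mathcal{A}_n^{\mathbb{Z}}$ there is at most one pair $(k,x)$ with $x \in X_{\boldsymbol{\tau}}^{(n+1)}$, $0 \le k < |\tau_n(x_0)|$ and $y = S^k \tau_n(x)$ (morphisms act on two-sided sequences by concatenation, the image of $x_0$ starting at coordinate $0$). Towers: for $a \in \mathcal{A}_n$, $[a] = \{x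 \in X_{\boldsymbol{\tau}}^{(n)} : x_0 = a\}$ and $\mathcal{T}_n(a) = \bigcup_{0 \le k < |\tau_{[0,n)}(a)|} S^k \tau_{[0,n)}([a])$. $\boldsymbol{\tau}$ is clean with respect to $\mu$ if: (1) there is $n_0$ such that $\mathcal{A}_n = \mathcal{A}_{n_0} =: \mathcal{A}$ for all $n \ge n_0$; and (2) there are $c > 0$ and $\mathcal{A}_\mu \subseteq \mathcal{A}$ such that $\mu(\mathcal{T}_n(a)) \ge c$ for all $n \ge n_0$, $a \in \mathcal{A}_\mu$, and $\lim_{n \to +\infty} \mu(\mathcal{T}_n(a)) = 0$ for all $a \in \mathcal{A} \setminus \mathcal{A}_\mu$. A measurable eigenvalue with respect to $\mu$ is a complex $\lambda$ for which there is $f \in L^2(X_{\boldsymbol{\tau}},\mu)$, $f \ne 0$, with $f \circ S = \lambda f$ ($\mu$-a.e.). $\operatorname{dist}(t,\mathbb{Z}) = \inf_{m \in \mathbb{Z}} |t-m|$. *)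

theory Defs
  imports "HOL-Probability.Probability" "HOL-Library.Sublist"
begin

section \<open>Morphisms and directive sequences\<close>

text \<open>
  All alphabets are subsets of one letter type. A morphism of free monoids is represented by its
  values on letters, \<open>\<sigma> :: 'a \<Rightarrow> 'a list\<close>; its values on letters outside the relevant alphabet are
  irrelevant. A directive sequence is a pair \<open>A\<close>, \<open>\<tau>\<close> with \<open>\<tau> n\<close> mapping letters of \<open>A (n+1)\<close> to
  nonempty words over \<open>A n\<close>.
\<close>

definition morph_word :: "('a \<Rightarrow> 'a list) \<Rightarrow> 'a list \<Rightarrow> 'a list" where
  "morph_word \<sigma> w = concat (map \<sigma> w)"

definition directive_sequence :: "(nat \<Rightarrow> 'a set) \<Rightarrow> (nat \<Rightarrow> 'a \<Rightarrow> 'a list) \<Rightarrow> bool" where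
  "directive_sequence A \<tau> \<longleftrightarrow>
     (\<forall>n. finite (A n)) \<and> (\<forall>n. \<forall>a\<in>A (Suc n). \<tau> n a \<noteq> [] \<and> set (\<tau> n a) \<subseteq> A n)"

text \<open>
  \<open>comp_morph \<tau> n N a\<close> is \<open>(\<tau> n \<circ> \<dots> \<circ> \<tau> (N-1)) a\<close>, and the one-letter word \<open>[a]\<close> if \<open>n = N\<close>.
\<close>

definition comp_morph :: "(nat \<Rightarrow> 'a \<Rightarrow> 'a list) \<Rightarrow> nat \<Rightarrow> nat \<Rightarrow> 'a \<Rightarrow> 'a list" where
  "comp_morph \<tau> n N a = foldr (\<lambda>i. morph_word (\<tau> i)) [n..<N] [a]"

definition tower_height :: "(nat \<Rightarrow> 'a \<Rightarrow> 'a list) \<Rightarrow> nat \<Rightarrow> 'a \<Rightarrow> nat" where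
  "tower_height \<tau> n a = length (comp_morph \<tau> 0 n a)"

definition min_length :: "'a set \<Rightarrow> ('a \<Rightarrow> 'a list) \<Rightarrow> nat" where
  "min_length B \<sigma> = Min ((\<lambda>a. length (\<sigma> a)) ` B)"

definition max_length :: "'a set \<Rightarrow> ('a \<Rightarrow> 'a list) \<Rightarrow> nat" where
  "max_length B \<sigma> = Max ((\<lambda>a. length (\<sigma> a)) ` B)"

text \<open>The factor \<open>w\<^sub>c \<dots> w\<^sub>d\<^sub>-\<^sub>1\<close>, meaningful for \<open>c \<le> d \<le> length w\<close>.\<close>

definition segment :: "'a list \<Rightarrow> nat \<Rightarrow> nat \<Rightarrow> 'a list" where
  "segment w c d = take (d - c) (drop c w)"

definition primitive :: "(nat \<Rightarrow> 'a set) \<Rightarrow> (nat \<Rightarrow> 'a \<Rightarrow> 'a list) \<Rightarrow> bool" where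
  "primitive A \<tau> \<longleftrightarrow> (\<forall>n. \<exists>N>n. \<forall>a\<in>A N. A n \<subseteq> set (comp_morph \<tau> n N a))"

definition proper :: "(nat \<Rightarrow> 'a set) \<Rightarrow> (nat \<Rightarrow> 'a \<Rightarrow> 'a list) \<Rightarrow> bool" where
  "proper A \<tau> \<longleftrightarrow>
     (\<forall>n. \<exists>p\<in>A n. \<exists>s\<in>A n. \<forall>a\<in>A (Suc n). hd (\<tau> n a) = p \<and> last (\<tau> n a) = s)"


section \<open>Two-sided sequences\<close>

definition seq_shift :: "(int \<Rightarrow> 'a) \<Rightarrow> int \<Rightarrow> 'a" where
  "seq_shift x = (\<lambda>i. x (i + 1))"

text \<open>
  \<open>offset \<sigma> x i\<close> is the coordinate at which the image of \<open>x i\<close> starts in \<open>\<sigma>(x)\<close>: it vanishes at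
  \<open>i = 0\<close> and grows by \<open>length (\<sigma> (x i))\<close> from \<open>i\<close> to \<open>i + 1\<close>, also for negative \<open>i\<close>.
  In \<open>morph_seq\<close> the description is unique and always satisfied when \<open>\<sigma>\<close> is nonerasing on the
  letters of \<open>x\<close>.
\<close>

definition offset :: "('a \<Rightarrow> 'a list) \<Rightarrow> (int \<Rightarrow> 'a) \<Rightarrow> int \<Rightarrow> int" where
  "offset \<sigma> x i =
     (\<Sum>j\<in>{0..<i}. int (length (\<sigma> (x j)))) - (\<Sum>j\<in>{i..<0}. int (length (\<sigma> (x j))))"

definition morph_seq :: "('a \<Rightarrow> 'a list) \<Rightarrow> (int \<Rightarrow> 'a) \<Rightarrow> int \<Rightarrow> 'a" where
  "morph_seq \<sigma> x = (\<lambda>m.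
     let i = (THE i. offset \<sigma> x i \<le> m \<and> m < offset \<sigma> x (i + 1))
     in \<sigma> (x i) ! nat (m - offset \<sigma> x i))"

definition level_subshift ::
    "(nat \<Rightarrow> 'a set) \<Rightarrow> (nat \<Rightarrow> 'a \<Rightarrow> 'a list) \<Rightarrow> nat \<Rightarrow> (int \<Rightarrow> 'a) set" where
  "level_subshift A \<tau> n =
     {x. (\<forall>i. x i \<in> A n) \<and>
         (\<forall>i l. \<exists>N>n. \<exists>a\<in>A N. sublist (map (\<lambda>j. x (i + int j)) [0..<l]) (comp_morph \<tau> n N a))}"

definition recognizable :: "(nat \<Rightarrow> 'a set) \<Rightarrow> (nat \<Rightarrow> 'a \<Rightarrow> 'a list) \<Rightarrow> bool" where
  "recognizable A \<tau> \<longleftrightarrow>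
     (\<forall>n y. (\<forall>i. y i \<in> A n) \<longrightarrow>
        Uniq (\<lambda>(k, x). x \<in> level_subshift A \<tau> (Suc n) \<and> k < length (\<tau> n (x 0)) \<and>
                       y = (seq_shift ^^ k) (morph_seq (\<tau> n) x)))"

definition tower ::
    "(nat \<Rightarrow> 'a set) \<Rightarrow> (nat \<Rightarrow> 'a \<Rightarrow> 'a list) \<Rightarrow> nat \<Rightarrow> 'a \<Rightarrow> (int \<Rightarrow> 'a) set" where
  "tower A \<tau> n a =
     (\<Union>k<tower_height \<tau> n a.
        (seq_shift ^^ k) ` morph_seq (comp_morph \<tau> 0 n) ` {x \<in> level_subshift A \<tau> n. x 0 = a})"


section \<open>Invariant measures and eigenvalues\<close>

text \<open>
  The Borel \<open>\<sigma>\<close>-algebra of \<open>X\<close>, for \<open>X\<close> a set of two-sided sequences over the discrete finite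
  alphabet \<open>B\<close>: as the index set is countable, it is the trace on \<open>X\<close> of the product \<open>\<sigma>\<close>-algebra.
\<close>

definition sequence_borel :: "'a set \<Rightarrow> (int \<Rightarrow> 'a) set \<Rightarrow> (int \<Rightarrow> 'a) measure" where
  "sequence_borel B X = restrict_space (Pi\<^sub>M UNIV (\<lambda>_. count_space B)) X"

definition ergodic_invariant_prob :: "'x measure \<Rightarrow> ('x \<Rightarrow> 'x) \<Rightarrow> bool" where
  "ergodic_invariant_prob M T \<longleftrightarrow>
     prob_space M \<and> T \<in> measurable M M \<and> distr M M T = M \<and>
     (\<forall>B\<in>sets M. T -` B \<inter> space M = B \<longrightarrow> measure M B = 0 \<or> measure M B = 1)"

definition measurable_eigenvalue :: "'x measure \<Rightarrow> ('x \<Rightarrow> 'x) \<Rightarrow> complex \<Rightarrow> bool" where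
  "measurable_eigenvalue M T z \<longleftrightarrow>
     (\<exists>f \<in> borel_measurable M. integrable M (\<lambda>x. (norm (f x))\<^sup>2) \<and>
        \<not> (AE x in M. f x = 0) \<and> (AE x in M. f (T x) = z * f x))"

definition clean ::
    "(nat \<Rightarrow> 'a set) \<Rightarrow> (nat \<Rightarrow> 'a \<Rightarrow> 'a list) \<Rightarrow> (int \<Rightarrow> 'a) measure \<Rightarrow> 'a set \<Rightarrow> bool" where
  "clean A \<tau> \<mu> A\<mu> \<longleftrightarrow>
     (\<exists>n\<^sub>0. (\<forall>n\<ge>n\<^sub>0. A n = A n\<^sub>0) \<and> A\<mu> \<subseteq> A n\<^sub>0 \<and>
        (\<exists>c>0. \<forall>n\<ge>n\<^sub>0. \<forall>a\<in>A\<mu>. measure \<mu> (tower A \<tau> n a) \<ge> c) \<and>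
        (\<forall>a\<in>A n\<^sub>0 - A\<mu>. (\<lambda>n. measure \<mu> (tower A \<tau> n a)) \<longlonglongrightarrow> 0))"

end

theory Submission
  imports Defs "HOL-Library.Diagonal_Subsequence"
begin

text \<open>
  Let \<open>f\<close> be an eigenfunction; by ergodicity \<open>\<bar>f\<bar>\<close> is bounded away from zero. Approximate \<open>f\<close> in
  \<open>L\<^sup>1\<close> by a function \<open>g\<close> of finitely many coordinates. Over the common word \<open>u\<^sub>n\<close>, the value of \<open>g\<close> on
  the \<open>j\<close>-th level of the towers over \<open>A\<mu>\<close> depends on \<open>j\<close> only, and these levels are a positive
  proportion of all levels. Transporting one well chosen level back to the base along the
  eigenvalue equation shows that \<open>f\<close> is nearly constant on the union of the bases of the towers over
  \<open>A\<mu>\<close>, relative to the measure of a single base. Since the remaining towers have vanishing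
  measure and all heights are comparable, a definite proportion of the base of the tower of \<open>a\<close>
  returns, after \<open>h\<^sub>n(a)\<close> steps, to such a base; there \<open>f\<close> has been multiplied by \<open>z ^ h\<^sub>n(a)\<close>,
  which must therefore be close to \<open>1\<close>.
\<close>


section \<open>Morphisms acting on two-sided sequences\<close>

text \<open>\<open>f\<close> is merely measurable, so no pointwise control on a base is available
  and every estimate is an integral. Two scales have to match. With \<open>H\<close> the least
  height at level \<open>n\<close>, averaging over about \<delta> * H floors bounds the integral of
  |f - w| over the bases by a small multiple of 1/H; the base of a tower over \<open>A\<mu>\<close>
  has measure at least \<kappa>/(K * H). The powers of \<open>H\<close> cancel, so all constants can
  be fixed before \<open>n\<close>. The window of \<open>g\<close> spoils only 2m floors, a number
  that does not grow with the heights. The word must be common to all of \<open>A\<mu>\<close>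
  because an orbit leaving the base over \<open>a\<close> may return to the base over another
  letter: one constant \<open>w\<close> has to serve all these bases at once. A separate obstacle is
  measurability: floors are images of sets, not preimages, and are shown to be closed by
  compactness.\<close>

lemma seq_shift_funpow: "(seq_shift ^^ k) x = (\<lambda>i. x (i + int k))"
  by (induction k) (auto simp: seq_shift_def algebra_simps)

lemma morph_word_Nil [simp]: "morph_word \<sigma> [] = []"
  and morph_word_Cons [simp]: "morph_word \<sigma> (a # w) = \<sigma> a @ morph_word \<sigma> w"
  and morph_word_append [simp]: "morph_word \<sigma> (v @ w) = morph_word \<sigma> v @ morph_word \<sigma> w"
  by (simp_all add: morph_word_def)

lemma sublist_morph_word: "sublist v w \<Longrightarrow> sublist (morph_word \<sigma> v) (morph_word \<sigma> w)"
  unfolding sublist_def by (metis morph_word_append)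

lemma foldr_morph_word_append:
  "foldr (\<lambda>i. morph_word (\<tau> i)) is (v @ w) =
     foldr (\<lambda>i. morph_word (\<tau> i)) is v @ foldr (\<lambda>i. morph_word (\<tau> i)) is w"
  by (induction "is") auto

lemma foldr_morph_word:
  "foldr (\<lambda>i. morph_word (\<tau> i)) is w =
     morph_word (\<lambda>a. foldr (\<lambda>i. morph_word (\<tau> i)) is [a]) w"
proof (induction w)
  case Nil
  show ?case by (induction "is") auto
next
  case (Cons a w)
  then show ?case
    using foldr_morph_word_append[of \<tau> "is" "[a]" w] by simp
qed

lemma comp_morph_refl [simp]: "comp_morph \<tau> n n a = [a]"
  by (simp add: comp_morph_def)

text \<open>This recursion splits off the innermost morphism and drives the inductions on the level
  of a tower; \<open>comp_morph_step\<close> splits off the outermost one and lets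
  \<open>\<tau> n\<close> carry words of level n + 1 to level n.\<close>

lemma comp_morph_Suc:
  assumes "n \<le> N"
  shows "comp_morph \<tau> n (Suc N) a = morph_word (comp_morph \<tau> n N) (\<tau> N a)"
  using foldr_morph_word[of \<tau> "[n..<N]" "\<tau> N a"] assms
  by (simp add: comp_morph_def[abs_def])

lemma comp_morph_step:
  assumes "n < N"
  shows "comp_morph \<tau> n N a = morph_word (\<tau> n) (comp_morph \<tau> (Suc n) N a)"
  using assms by (simp add: comp_morph_def upt_conv_Cons)

section \<open>Windows and block boundaries\<close>

definition window :: "(int \<Rightarrow> 'a) \<Rightarrow> int \<Rightarrow> nat \<Rightarrow> 'a list" where
  "window x i l = map (\<lambda>j. x (i + int j)) [0..<l]"

lemma length_window [simp]: "length (window x i l) = l"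
  and nth_window: "k < l \<Longrightarrow> window x i l ! k = x (i + int k)"
  and window_0 [simp]: "window x i 0 = []"
  and window_1: "window x i (Suc 0) = [x i]"
  by (simp_all add: window_def)

lemma window_add: "window x i (k + l) = window x i k @ window x (i + int k) l"
  by (rule nth_equalityI) (auto simp: nth_window nth_append)

lemma window_Suc: "window x i (Suc l) = window x i l @ [x (i + int l)]"
  by (simp add: window_def)

lemma sublist_window:
  assumes "i \<le> j" "j + int l \<le> i + int k"
  shows "sublist (window x j l) (window x i k)"
proof -
  define p q where "p = nat (j - i)" and "q = nat (i + int k - j - int l)"
  have "k = p + (l + q)" "j = i + int p"
    using assms by (simp_all add: p_def q_def)
  then have "window x i k = window x i p @ window x j l @ window x (j + int l) q"
    by (simp add: window_add)
  then show ?thesis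
    by (metis sublist_appendI)
qed

lemma offset_0 [simp]: "offset \<sigma> x 0 = 0"
  by (simp add: offset_def)

lemma offset_Suc: "offset \<sigma> x (i + 1) = offset \<sigma> x i + int (length (\<sigma> (x i)))"
proof (cases "0 \<le> i")
  case True
  then have "{0..<i + 1} = insert i {0..<i}" "{i + 1..<0} = {}" "{i..<0} = {}" by auto
  then show ?thesis by (simp add: offset_def)
next
  case False
  then have "{i..<0} = insert i {i + 1..<0}" "{0..<i} = {}" "{0..<i + 1} = {}" by auto
  then show ?thesis by (simp add: offset_def)
qed

lemma offset_add_nat:
  "offset \<sigma> x (i + int l) = offset \<sigma> x i + int (length (morph_word \<sigma> (window x i l)))"
proof (induction l)
  case (Suc l)
  have "offset \<sigma> x (i + int (Suc l)) = offset \<sigma> x ((i + int l) + 1)" by (simp add: algebra_simps)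
  with Suc show ?case by (simp add: offset_Suc window_Suc)
qed simp

lemma offset_cong:
  assumes "\<And>j. \<bar>j\<bar> \<le> \<bar>i\<bar> \<Longrightarrow> x j = y j"
  shows "offset \<sigma> x i = offset \<sigma> y i"
  unfolding offset_def by (intro arg_cong2[where f = minus] sum.cong) (auto simp: assms)

text \<open>Cocycle rule: both sides vanish at \<open>i = 0\<close> and grow by the length of
  \<open>\<sigma> (x (i + k))\<close> from \<open>i\<close> to \<open>i + 1\<close>.\<close>

lemma offset_translate:
  "offset \<sigma> (\<lambda>i. x (i + k)) i = offset \<sigma> x (i + k) - offset \<sigma> x k"
proof (induction i rule: int_induct[where k = 0])
  case base
  show ?case by simp
next
  case (step1 i)
  then show ?case
    using offset_Suc[of \<sigma> x "i + k"] offset_Suc[of \<sigma> "\<lambda>i. x (i + k)" i]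
    by (simp add: algebra_simps)
next
  case (step2 i)
  then show ?case
    using offset_Suc[of \<sigma> x "i + k - 1"] offset_Suc[of \<sigma> "\<lambda>i. x (i + k)" "i - 1"]
    by (simp add: algebra_simps)
qed

lemma length_word_ge:
  assumes "\<And>a. a \<in> set w \<Longrightarrow> \<sigma> a \<noteq> []"
  shows "length w \<le> length (morph_word \<sigma> w)"
  using assms
proof (induction w)
  case (Cons a w)
  then have "\<sigma> a \<noteq> []" "length w \<le> length (morph_word \<sigma> w)" by auto
  then show ?case by (cases "\<sigma> a") auto
qed simp

lemma offset_ge:
  assumes "\<And>i. \<sigma> (x i) \<noteq> []" "i \<le> j"
  shows "offset \<sigma> x i + (j - i) \<le> offset \<sigma> x j"
proof -
  have "length (window x i (nat (j - i))) \<le> length (morph_word \<sigma> (window x i (nat (j - i))))"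
    by (rule length_word_ge) (auto simp: window_def assms)
  then show ?thesis
    using offset_add_nat[of \<sigma> x i "nat (j - i)"] assms(2) by simp
qed

lemma offset_less:
  assumes "\<And>i. \<sigma> (x i) \<noteq> []" "i < j"
  shows "offset \<sigma> x (i + 1) \<le> offset \<sigma> x j"
  using offset_ge[of \<sigma> x "i + 1" j] assms by simp

text \<open>When \<open>m\<close> moves by one it stays in its block or crosses into the adjacent
  one, which is nonempty; hence an induction in both directions from 0.\<close>

lemma offset_locate:
  assumes ne: "\<And>i. \<sigma> (x i) \<noteq> []"
  shows "\<exists>i. offset \<sigma> x i \<le> m \<and> m < offset \<sigma> x (i + 1)"
proof (induction m rule: int_induct[where k = 0])
  case base
  show ?case by (intro exI[of _ 0]) (use ne in \<open>simp add: offset_Suc[of _ _ 0, simplified]\<close>)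
next
  case (step1 m)
  then obtain i where i: "offset \<sigma> x i \<le> m" "m < offset \<sigma> x (i + 1)" by blast
  show ?case
  proof (cases "m + 1 < offset \<sigma> x (i + 1)")
    case False
    then show ?thesis
      using i offset_ge[of \<sigma> x "i + 1" "i + 1 + 1"] ne by (intro exI[of _ "i + 1"]) auto
  qed (use i in force)
next
  case (step2 m)
  then obtain i where i: "offset \<sigma> x i \<le> m" "m < offset \<sigma> x (i + 1)" by blast
  show ?case
  proof (cases "offset \<sigma> x i \<le> m - 1")
    case False
    then show ?thesis
      using i offset_ge[of \<sigma> x "i - 1" i] ne by (intro exI[of _ "i - 1"]) auto
  qed (use i in force)
qed

lemma offset_unique:
  assumes "\<And>i. \<sigma> (x i) \<noteq> []"
    and "offset \<sigma> x i \<le> m" "m < offset \<sigma> x (i + 1)"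
    and "offset \<sigma> x j \<le> m" "m < offset \<sigma> x (j + 1)"
  shows "i = j"
  using offset_less[of \<sigma> x i j] offset_less[of \<sigma> x j i] assms by (cases i j rule: linorder_cases) auto

lemma morph_seq_eq:
  assumes "\<And>i. \<sigma> (x i) \<noteq> []" "offset \<sigma> x i \<le> m" "m < offset \<sigma> x (i + 1)"
  shows "morph_seq \<sigma> x m = \<sigma> (x i) ! nat (m - offset \<sigma> x i)"
proof -
  have "(THE i. offset \<sigma> x i \<le> m \<and> m < offset \<sigma> x (i + 1)) = i"
    using assms(2,3) offset_unique[of \<sigma> x, OF assms(1)] by blast
  then show ?thesis by (simp add: morph_seq_def)
qed

lemma window_morph_seq1:
  assumes "\<And>i. \<sigma> (x i) \<noteq> []"
  shows "window (morph_seq \<sigma> x) (offset \<sigma> x i) (length (\<sigma> (x i))) = \<sigma> (x i)"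
  using assms by (intro nth_equalityI) (auto simp: nth_window morph_seq_eq[where i = i] offset_Suc)

lemma window_morph_seq:
  assumes "\<And>i. \<sigma> (x i) \<noteq> []"
  shows "window (morph_seq \<sigma> x) (offset \<sigma> x i) (length (morph_word \<sigma> (window x i l))) =
    morph_word \<sigma> (window x i l)"
proof (induction l)
  case (Suc l)
  then show ?case
    using window_morph_seq1[of \<sigma> x "i + int l", OF assms] offset_add_nat[of \<sigma> x i l]
    by (simp add: window_Suc window_add)
qed simp

text \<open>With the image characterised by its block words, translations and compositions are
  settled block by block, without returning to the \<open>THE\<close> in
  \<open>morph_seq\<close>.\<close>

lemma morph_seq_eqI:
  assumes ne: "\<And>i. \<sigma> (x i) \<noteq> []"
    and "\<And>i. window y (offset \<sigma> x i) (length (\<sigma> (x i))) = \<sigma> (x i)"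
  shows "morph_seq \<sigma> x = y"
proof
  fix m
  obtain i where i: "offset \<sigma> x i \<le> m" "m < offset \<sigma> x (i + 1)"
    using offset_locate[of \<sigma> x, OF ne] by blast
  then have "nat (m - offset \<sigma> x i) < length (\<sigma> (x i))"
    by (simp add: offset_Suc)
  from nth_window[OF this, of y "offset \<sigma> x i"] show "morph_seq \<sigma> x m = y m"
    using i by (simp add: morph_seq_eq[OF ne i] assms(2))
qed

lemma morph_seq_translate:
  assumes ne: "\<And>i. \<sigma> (x i) \<noteq> []"
  shows "morph_seq \<sigma> (\<lambda>i. x (i + k)) = (\<lambda>m. morph_seq \<sigma> x (m + offset \<sigma> x k))"
proof (rule morph_seq_eqI)
  fix i
  have "window (\<lambda>m. morph_seq \<sigma> x (m + offset \<sigma> x k)) (offset \<sigma> (\<lambda>i. x (i + k)) i) l =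
      window (morph_seq \<sigma> x) (offset \<sigma> x (i + k)) l" for l
    by (simp add: window_def offset_translate algebra_simps)
  then show "window (\<lambda>m. morph_seq \<sigma> x (m + offset \<sigma> x k)) (offset \<sigma> (\<lambda>i. x (i + k)) i)
      (length (\<sigma> (x (i + k)))) = \<sigma> (x (i + k))"
    using window_morph_seq1[of \<sigma> x "i + k", OF ne] by simp
qed (rule ne)

lemma morph_seq_local:
  assumes ne: "\<And>i. \<sigma> (x i) \<noteq> []"
  shows "\<exists>r. \<forall>y. (\<forall>i. \<sigma> (y i) \<noteq> []) \<longrightarrow> (\<forall>i. \<bar>i\<bar> \<le> r \<longrightarrow> y i = x i) \<longrightarrow>
    morph_seq \<sigma> y m = morph_seq \<sigma> x m"
proof -
  obtain i where i: "offset \<sigma> x i \<le> m" "m < offset \<sigma> x (i + 1)"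
    using offset_locate[of \<sigma> x, OF ne] by blast
  show ?thesis
  \<comment> \<open>Block \<open>i\<close> is located by both its boundaries; for the right one
    \<open>offset_cong\<close> asks for agreement up to |i + 1|.\<close>
  proof (intro exI[of _ "\<bar>i\<bar> + 1"] allI impI)
    fix y :: "int \<Rightarrow> 'a"
    assume "\<forall>i. \<sigma> (y i) \<noteq> []" "\<forall>j. \<bar>j\<bar> \<le> \<bar>i\<bar> + 1 \<longrightarrow> y j = x j"
    then have y: "\<And>i. \<sigma> (y i) \<noteq> []" "\<And>j. \<bar>j\<bar> \<le> \<bar>i\<bar> + 1 \<Longrightarrow> y j = x j" by auto
    have "offset \<sigma> y i = offset \<sigma> x i" "offset \<sigma> y (i + 1) = offset \<sigma> x (i + 1)"
      by (auto intro!: offset_cong y)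
    then show "morph_seq \<sigma> y m = morph_seq \<sigma> x m"
      using morph_seq_eq[of \<sigma> x i m, OF ne i] morph_seq_eq[of \<sigma> y i m, OF y(1)] i y(2)[of i] by simp
  qed
qed

section \<open>Composition of morphisms on sequences\<close>

context
  fixes \<sigma> \<tau> \<rho> :: "'a \<Rightarrow> 'a list" and x :: "int \<Rightarrow> 'a"
  assumes ne: "\<And>i. \<tau> (x i) \<noteq> []" and ne': "\<And>i. \<sigma> (morph_seq \<tau> x i) \<noteq> []"
    and comp: "\<And>i. \<rho> (x i) = morph_word \<sigma> (\<tau> (x i))"
begin

lemma offset_comp_step:
  "offset \<sigma> (morph_seq \<tau> x) (offset \<tau> x (i + 1)) =
    offset \<sigma> (morph_seq \<tau> x) (offset \<tau> x i) + int (length (\<rho> (x i)))"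
  using offset_add_nat[of \<sigma> "morph_seq \<tau> x" "offset \<tau> x i" "length (\<tau> (x i))"]
  by (simp add: offset_Suc comp window_morph_seq1[of \<tau> x, OF ne])

lemma offset_comp: "offset \<rho> x i = offset \<sigma> (morph_seq \<tau> x) (offset \<tau> x i)"
proof (induction i rule: int_induct[where k = 0])
  case (step1 i)
  then show ?case
    using offset_comp_step[of i] offset_Suc[of \<rho> x i] by simp
next
  case (step2 i)
  then show ?case
    using offset_comp_step[of "i - 1"] offset_Suc[of \<rho> x "i - 1"] by simp
qed simp

lemma morph_seq_comp: "morph_seq \<rho> x = morph_seq \<sigma> (morph_seq \<tau> x)"
proof (rule morph_seq_eqI)
  fix i
  \<comment> \<open>The letters of \<open>\<tau> (x i)\<close> occur in
    \<open>morph_seq \<tau> x\<close>, the only place where \<sigma> is known to be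
    nonerasing.\<close>
  have "length (\<tau> (x i)) \<le> length (morph_word \<sigma> (\<tau> (x i)))"
    using window_morph_seq1[of \<tau> x i, OF ne] ne'
    by (intro length_word_ge) (metis (no_types, lifting) imageE list.set_map window_def)
  then show "\<rho> (x i) \<noteq> []"
    using ne[of i] by (auto simp: comp)
  show "window (morph_seq \<sigma> (morph_seq \<tau> x)) (offset \<rho> x i) (length (\<rho> (x i))) = \<rho> (x i)"
    using window_morph_seq[of \<sigma> "morph_seq \<tau> x" "offset \<tau> x i" "length (\<tau> (x i))", OF ne']
    by (simp add: window_morph_seq1[of \<tau> x, OF ne] comp offset_comp)
qed

end

section \<open>Subshifts of the levels\<close>

lemma level_subshift_iff:
  "x \<in> level_subshift A \<tau> n \<longleftrightarrow> (\<forall>i. x i \<in> A n) \<and>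
    (\<forall>i l. \<exists>N>n. \<exists>a\<in>A N. sublist (window x i l) (comp_morph \<tau> n N a))"
  by (simp add: level_subshift_def window_def)

lemma level_subshift_letter: "x \<in> level_subshift A \<tau> n \<Longrightarrow> x i \<in> A n"
  by (simp add: level_subshift_iff)

lemma level_subshift_closed:
  assumes "\<And>r. \<exists>y\<in>level_subshift A \<tau> n. \<forall>i. \<bar>i\<bar> \<le> r \<longrightarrow> y i = x i"
  shows "x \<in> level_subshift A \<tau> n"
  unfolding level_subshift_iff
proof safe
  fix i
  show "x i \<in> A n"
    using assms[of "\<bar>i\<bar>"] level_subshift_letter[of _ A \<tau> n i] by force
next
  fix i l
  obtain y where y: "y \<in> level_subshift A \<tau> n" "\<And>j. \<bar>j\<bar> \<le> \<bar>i\<bar> + int l \<Longrightarrow> y j = x j"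
    using assms by blast
  then have "window x i l = window y i l"
    by (auto simp: window_def)
  then show "\<exists>N>n. \<exists>a\<in>A N. sublist (window x i l) (comp_morph \<tau> n N a)"
    using y(1) by (simp add: level_subshift_iff)
qed

lemma level_subshift_translate:
  assumes "x \<in> level_subshift A \<tau> n"
  shows "(\<lambda>i. x (i + k)) \<in> level_subshift A \<tau> n"
proof -
  have "window (\<lambda>i. x (i + k)) i l = window x (i + k) l" for i l
    by (simp add: window_def algebra_simps)
  then show ?thesis
    using assms by (simp add: level_subshift_iff)
qed

lemma directive_sequenceD:
  assumes "directive_sequence A \<tau>"
  shows "finite (A n)" "a \<in> A (Suc n) \<Longrightarrow> \<tau> n a \<noteq> []" "a \<in> A (Suc n) \<Longrightarrow> set (\<tau> n a) \<subseteq> A n"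
  using assms by (auto simp: directive_sequence_def)

lemma comp_morph_nonempty:
  assumes D: "directive_sequence A \<tau>" and "n \<le> N" "a \<in> A N"
  shows "comp_morph \<tau> n N a \<noteq> []"
  using assms(2,3)
proof (induction N arbitrary: a rule: dec_induct)
  case (step N)
  have "length (\<tau> N a) \<le> length (morph_word (comp_morph \<tau> n N) (\<tau> N a))"
    using step directive_sequenceD(3)[OF D, of a N] by (intro length_word_ge) auto
  then show ?case
    using directive_sequenceD(2)[OF D step.prems] step by (auto simp: comp_morph_Suc)
qed simp

text \<open>A window of the image is covered by the image of a window of \<open>x\<close>. The
  latter occurs in some \<open>comp_morph \<tau> (Suc n) N a\<close>, which \<open>\<tau> n\<close>
  maps to \<open>comp_morph \<tau> n N a\<close>.\<close>

lemma morph_seq_level_subshift: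
  assumes D: "directive_sequence A \<tau>" and x: "x \<in> level_subshift A \<tau> (Suc n)"
  shows "morph_seq (\<tau> n) x \<in> level_subshift A \<tau> n"
  unfolding level_subshift_iff
proof safe
  have xA: "x i \<in> A (Suc n)" for i
    using x by (rule level_subshift_letter)
  have ne: "\<tau> n (x i) \<noteq> []" for i
    using xA directive_sequenceD(2)[OF D] by blast
  let ?y = "morph_seq (\<tau> n) x"
  show "?y m \<in> A n" for m
  proof -
    obtain i where i: "offset (\<tau> n) x i \<le> m" "m < offset (\<tau> n) x (i + 1)"
      using offset_locate[of "\<tau> n" x, OF ne] by blast
    then have "?y m \<in> set (\<tau> n (x i))"
      by (subst morph_seq_eq[OF ne i]) (auto simp: offset_Suc intro!: nth_mem)
    then show ?thesis
      using directive_sequenceD(3)[OF D xA] by blast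
  qed
  fix m l
  obtain i where i: "offset (\<tau> n) x i \<le> m" "m < offset (\<tau> n) x (i + 1)"
    using offset_locate[of "\<tau> n" x, OF ne] by blast
  \<comment> \<open>\<open>Suc l\<close> letters suffice: letter \<open>i\<close> covers
    \<open>m\<close>, and each of the next \<open>l\<close> letters adds at least one
    coordinate.\<close>
  let ?w = "window x i (Suc l)"
  have "m + int l \<le> offset (\<tau> n) x (i + int (Suc l))"
    using i offset_ge[of "\<tau> n" x "i + 1" "i + int (Suc l)"] ne by simp
  then have *: "sublist (window ?y m l) (morph_word (\<tau> n) ?w)"
    using sublist_window[of "offset (\<tau> n) x i" m l "length (morph_word (\<tau> n) ?w)" ?y] i(1)
    by (simp only: offset_add_nat window_morph_seq[of "\<tau> n" x, OF ne])
  obtain N a where N: "N > Suc n" "a \<in> A N" "sublist ?w (comp_morph \<tau> (Suc n) N a)"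
    using x unfolding level_subshift_iff by blast
  then have "sublist (morph_word (\<tau> n) ?w) (comp_morph \<tau> n N a)"
    by (simp add: comp_morph_step sublist_morph_word)
  with * N show "\<exists>N>n. \<exists>a\<in>A N. sublist (window ?y m l) (comp_morph \<tau> n N a)"
    by (intro exI[of _ N]) (auto intro: sublist_order.order.trans)
qed

lemma comp_morph_level_nonempty:
  assumes "directive_sequence A \<tau>" "x \<in> level_subshift A \<tau> n"
  shows "comp_morph \<tau> 0 n (x i) \<noteq> []"
  using assms by (simp add: comp_morph_nonempty level_subshift_letter)

lemma
  assumes D: "directive_sequence A \<tau>" and x: "x \<in> level_subshift A \<tau> (Suc n)"
  shows morph_seq_comp_Suc:
      "morph_seq (comp_morph \<tau> 0 (Suc n)) x = morph_seq (comp_morph \<tau> 0 n) (morph_seq (\<tau> n) x)"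
    and offset_comp_Suc: "offset (comp_morph \<tau> 0 (Suc n)) x i =
      offset (comp_morph \<tau> 0 n) (morph_seq (\<tau> n) x) (offset (\<tau> n) x i)"
proof -
  have *: "\<tau> n (x i) \<noteq> []" "comp_morph \<tau> 0 n (morph_seq (\<tau> n) x i) \<noteq> []" for i
    using directive_sequenceD(2)[OF D level_subshift_letter[OF x]]
      comp_morph_level_nonempty[OF D morph_seq_level_subshift[OF D x]] by auto
  show "morph_seq (comp_morph \<tau> 0 (Suc n)) x = morph_seq (comp_morph \<tau> 0 n) (morph_seq (\<tau> n) x)"
    by (rule morph_seq_comp) (use * in \<open>auto simp: comp_morph_Suc\<close>)
  show "offset (comp_morph \<tau> 0 (Suc n)) x i =
      offset (comp_morph \<tau> 0 n) (morph_seq (\<tau> n) x) (offset (\<tau> n) x i)"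
    by (rule offset_comp) (use * in \<open>auto simp: comp_morph_Suc\<close>)
qed

lemma morph_seq_singleton: "morph_seq (\<lambda>a. [a]) x = x"
proof -
  have "offset (\<lambda>a. [a]) x i = i" for i :: int
    by (simp add: offset_def)
  then show ?thesis
    by (intro morph_seq_eqI) (auto simp: window_1)
qed

lemma comp_morph_level_subshift:
  assumes D: "directive_sequence A \<tau>" and "x \<in> level_subshift A \<tau> n"
  shows "morph_seq (comp_morph \<tau> 0 n) x \<in> level_subshift A \<tau> 0"
  using assms(2)
proof (induction n arbitrary: x)
  case 0
  then show ?case by (simp add: morph_seq_singleton)
next
  case (Suc n)
  then show ?case by (simp add: morph_seq_comp_Suc[OF D] morph_seq_level_subshift[OF D])
qed

lemma tower_height_eq_offset: "int (tower_height \<tau> n (x 0)) = offset (comp_morph \<tau> 0 n) x 1"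
  using offset_Suc[of "comp_morph \<tau> 0 n" x 0] by (simp add: tower_height_def)

text \<open>Positions in a tower behave like numbers in mixed radix: \<open>k\<close> splits into a
  letter position \<open>i\<close> inside \<open>\<tau> n (x 0)\<close> and a height
  \<open>j\<close> in the level-n tower of that letter. The induction hypothesis identifies
  \<open>j\<close> and the level-n point; recognizability of the single morphism
  \<open>\<tau> n\<close> then identifies \<open>i\<close> and \<open>x\<close>.\<close>

lemma comp_morph_recognizable:
  assumes D: "directive_sequence A \<tau>" and R: "recognizable A \<tau>"
    and "x \<in> level_subshift A \<tau> n" "y \<in> level_subshift A \<tau> n"
    and "k < tower_height \<tau> n (x 0)" "l < tower_height \<tau> n (y 0)"
    and "(seq_shift ^^ k) (morph_seq (comp_morph \<tau> 0 n) x) =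
      (seq_shift ^^ l) (morph_seq (comp_morph \<tau> 0 n) y)"
  shows "k = l \<and> x = y"
  using assms(3-)
proof (induction n arbitrary: x y k l)
  case 0
  then show ?case by (simp add: tower_height_def morph_seq_singleton)
next
  case (Suc n)
  let ?\<sigma> = "comp_morph \<tau> 0 n" and ?t = "morph_seq (\<tau> n)"
  have *: "\<exists>i j. i < length (\<tau> n (x 0)) \<and> j < tower_height \<tau> n ((seq_shift ^^ i) (?t x) 0) \<and>
      int k = offset ?\<sigma> (?t x) (int i) + int j \<and>
      (seq_shift ^^ k) (morph_seq (comp_morph \<tau> 0 (Suc n)) x) =
      (seq_shift ^^ j) (morph_seq ?\<sigma> ((seq_shift ^^ i) (?t x)))"
    if x: "x \<in> level_subshift A \<tau> (Suc n)" and k: "k < tower_height \<tau> (Suc n) (x 0)" for x k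
  proof -
    have tx: "?t x \<in> level_subshift A \<tau> n"
      by (rule morph_seq_level_subshift[OF D x])
    have ne: "?\<sigma> (?t x i) \<noteq> []" for i
      using comp_morph_level_nonempty[OF D tx] .
    obtain i where i: "offset ?\<sigma> (?t x) i \<le> int k" "int k < offset ?\<sigma> (?t x) (i + 1)"
      using offset_locate[of ?\<sigma> "?t x", OF ne] by blast
    have "i \<ge> 0"
      using offset_less[of ?\<sigma> "?t x" i 0] ne i by force
    \<comment> \<open>By \<open>offset_comp_Suc\<close> the tower over \<open>x 0\<close> ends where
      the image of the last letter of \<open>\<tau> n (x 0)\<close> ends, which confines
      \<open>i\<close> to that word.\<close>
    have "int k < offset ?\<sigma> (?t x) (offset (\<tau> n) x 1)"
      using k by (simp flip: offset_comp_Suc[OF D x] tower_height_eq_offset of_nat_less_iff)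
    then have "i < offset (\<tau> n) x 1"
      using offset_ge[of ?\<sigma> "?t x" "offset (\<tau> n) x 1" i] ne i by force
    then have i': "nat i < length (\<tau> n (x 0))"
      using offset_Suc[of "\<tau> n" x 0] \<open>i \<ge> 0\<close> by simp
    let ?j = "nat (int k - offset ?\<sigma> (?t x) i)"
    have "?j < tower_height \<tau> n ((seq_shift ^^ nat i) (?t x) 0)"
      using i \<open>i \<ge> 0\<close> by (simp add: seq_shift_funpow offset_Suc tower_height_def)
    moreover have "(seq_shift ^^ k) (morph_seq (comp_morph \<tau> 0 (Suc n)) x) =
      (seq_shift ^^ ?j) (morph_seq ?\<sigma> ((seq_shift ^^ nat i) (?t x)))"
      using i \<open>i \<ge> 0\<close>
      by (simp add: seq_shift_funpow morph_seq_comp_Suc[OF D x] morph_seq_translate[of ?\<sigma> "?t x", OF ne]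
          algebra_simps)
    ultimately show ?thesis
      using i i' \<open>i \<ge> 0\<close> by (intro exI[of _ "nat i"] exI[of _ ?j]) auto
  qed
  obtain i j where ij: "i < length (\<tau> n (x 0))" "j < tower_height \<tau> n ((seq_shift ^^ i) (?t x) 0)"
      "int k = offset ?\<sigma> (?t x) (int i) + int j"
      "(seq_shift ^^ k) (morph_seq (comp_morph \<tau> 0 (Suc n)) x) =
      (seq_shift ^^ j) (morph_seq ?\<sigma> ((seq_shift ^^ i) (?t x)))"
    using *[OF Suc.prems(1,3)] by blast
  obtain i' j' where ij': "i' < length (\<tau> n (y 0))"
      "j' < tower_height \<tau> n ((seq_shift ^^ i') (?t y) 0)"
      "int l = offset ?\<sigma> (?t y) (int i') + int j'"
      "(seq_shift ^^ l) (morph_seq (comp_morph \<tau> 0 (Suc n)) y) =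
      (seq_shift ^^ j') (morph_seq ?\<sigma> ((seq_shift ^^ i') (?t y)))"
    using *[OF Suc.prems(2,4)] by blast
  have lev: "(seq_shift ^^ i) (?t x) \<in> level_subshift A \<tau> n"
    "(seq_shift ^^ i') (?t y) \<in> level_subshift A \<tau> n"
    using level_subshift_translate[OF morph_seq_level_subshift[OF D]] Suc.prems(1,2)
    by (auto simp: seq_shift_funpow)
  have eq: "j = j'" "(seq_shift ^^ i) (?t x) = (seq_shift ^^ i') (?t y)"
    using Suc.IH[OF lev ij(2) ij'(2)] Suc.prems(5) ij(4) ij'(4) by auto
  have "Uniq (\<lambda>(k, z). z \<in> level_subshift A \<tau> (Suc n) \<and> k < length (\<tau> n (z 0)) \<and>
      (seq_shift ^^ i) (?t x) = (seq_shift ^^ k) (?t z))"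
    using R[unfolded recognizable_def, rule_format, of "(seq_shift ^^ i) (?t x)" n]
      level_subshift_letter[OF lev(1)] by blast
  then have "(i, x) = (i', y)"
    by (rule Uniq_D) (use Suc.prems ij ij' eq in auto)
  then show ?case
    using eq ij(3) ij'(3) by auto
qed


section \<open>Compactness and measurability of towers\<close>

definition agree :: "int \<Rightarrow> (int \<Rightarrow> 'a) \<Rightarrow> (int \<Rightarrow> 'a) \<Rightarrow> bool" where
  "agree r x y \<longleftrightarrow> (\<forall>i. \<bar>i\<bar> \<le> r \<longrightarrow> x i = y i)"

lemma agree_mono: "agree r x y \<Longrightarrow> s \<le> r \<Longrightarrow> agree s x y"
  by (auto simp: agree_def)

text \<open>Closedness in the product of discrete topologies, written with \<open>agree\<close>
  since the letters form a bare type without a topology.\<close>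

definition pointwise_closed :: "(int \<Rightarrow> 'a) set \<Rightarrow> bool" where
  "pointwise_closed C \<longleftrightarrow> (\<forall>x. (\<forall>r. \<exists>y\<in>C. agree r y x) \<longrightarrow> x \<in> C)"

text \<open>Pigeonhole at each single coordinate, then a diagonal subsequence along the enumeration
  \<open>int_decode\<close> of the coordinates.\<close>

lemma pointwise_convergent_subseq:
  fixes y :: "nat \<Rightarrow> int \<Rightarrow> 'a"
  assumes "finite B" "\<And>l i. y l i \<in> B"
  obtains s z where "strict_mono s" "\<And>i. \<forall>\<^sub>F l in sequentially. y (s l) i = z i"
proof -
  define P where "P n s \<longleftrightarrow> (\<exists>v. \<forall>\<^sub>F l in sequentially. y (s l) (int_decode n) = v)" for n s
  interpret subseqs P
  proof
    fix n and s :: "nat \<Rightarrow> nat"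
    have "\<exists>v\<in>B. infinite {l \<in> UNIV. y (s l) (int_decode n) = v}"
      by (rule pigeonhole_infinite_rel) (use assms in auto)
    then obtain v where "infinite {l. y (s l) (int_decode n) = v}" by auto
    from infinite_enumerate[OF this] obtain r :: "nat \<Rightarrow> nat"
      where "strict_mono r" "\<And>l. r l \<in> {l. y (s l) (int_decode n) = v}" by blast
    then show "\<exists>r. strict_mono r \<and> P n (s \<circ> r)"
      by (intro exI[of _ r]) (auto simp: P_def)
  qed
  have *: "P n (diagseq \<circ> (+) (Suc n))" for n
  proof (rule diagseq_holds, goal_cases)
    case (1 r s n)
    then show ?case
      unfolding P_def using eventually_subseq[of r] by (auto simp: o_def)
  qed
  have "\<exists>v. \<forall>\<^sub>F l in sequentially. y (diagseq l) i = v" for i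
  proof -
    \<comment> \<open>The property holds for the diagonal after an initial part is dropped; eventual
      constancy does not see that part.\<close>
    from *[of "int_encode i"] obtain v where "\<forall>\<^sub>F l in sequentially. y (diagseq (l + Suc (int_encode i))) i = v"
      unfolding P_def by (auto simp: add.commute)
    then show ?thesis
      using eventually_sequentially_seg[of "\<lambda>l. y (diagseq l) i = v"] by blast
  qed
  then obtain z where "\<And>i. \<forall>\<^sub>F l in sequentially. y (diagseq l) i = z i"
    by metis
  then show thesis
    by (rule that[OF subseq_diagseq])
qed

text \<open>A continuous image of a compact set is closed; \<open>local\<close> is the continuity of
  each coordinate of \<open>\<Phi>\<close>. This is how floors, given as images under
  \<open>morph_seq\<close>, become measurable.\<close>

lemma pointwise_closed_image:
  assumes "finite B" and YB: "\<And>y i. y \<in> Y \<Longrightarrow> y i \<in> B" and "pointwise_closed Y"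
    and local: "\<And>y m. y \<in> Y \<Longrightarrow> \<exists>r. \<forall>y'\<in>Y. agree r y' y \<longrightarrow> \<Phi> y' m = \<Phi> y m"
  shows "pointwise_closed (\<Phi> ` Y)"
  unfolding pointwise_closed_def
proof safe
  fix x assume *: "\<forall>r. \<exists>u\<in>\<Phi> ` Y. agree r u x"
  have "\<exists>y\<in>Y. agree (int l) (\<Phi> y) x" for l
    using *[rule_format, of "int l"] by blast
  then obtain y where y: "\<And>l. y l \<in> Y" "\<And>l. agree (int l) (\<Phi> (y l)) x"
    by metis
  obtain s z where s: "strict_mono s" and z: "\<And>i. \<forall>\<^sub>F l in sequentially. y (s l) i = z i"
    using pointwise_convergent_subseq[of B y] assms(1) YB y(1) by blast
  have ev: "\<forall>\<^sub>F l in sequentially. agree r (y (s l)) z" for r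
  proof -
    have "\<forall>\<^sub>F l in sequentially. \<forall>i\<in>{-r..r}. y (s l) i = z i"
      using z by (simp add: eventually_ball_finite)
    then show ?thesis
      by eventually_elim (auto simp: agree_def abs_le_iff minus_le_iff)
  qed
  have "z \<in> Y"
  proof -
    have "\<exists>y\<in>Y. agree r y z" for r
      using eventually_happens[OF ev[of r]] y(1) by auto
    then show ?thesis
      using \<open>pointwise_closed Y\<close> by (auto simp: pointwise_closed_def)
  qed
  moreover have "\<Phi> z m = x m" for m
  proof -
    obtain r where r: "\<And>y'. y' \<in> Y \<Longrightarrow> agree r y' z \<Longrightarrow> \<Phi> y' m = \<Phi> z m"
      using local[OF \<open>z \<in> Y\<close>] by blast
    have "\<forall>\<^sub>F l in sequentially. nat \<bar>m\<bar> \<le> l \<and> agree r (y (s l)) z"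
      by (rule eventually_conj[OF eventually_ge_at_top ev])
    then obtain l where l: "nat \<bar>m\<bar> \<le> l" "agree r (y (s l)) z"
      using eventually_happens'[OF sequentially_bot] by blast
    \<comment> \<open>The image of \<open>y (s l)\<close> matches \<open>x\<close> on radius
      \<open>s l\<close>, which has to reach coordinate \<open>m\<close>.\<close>
    have "nat \<bar>m\<bar> \<le> s l"
      using l(1) s seq_suble[of s l] by linarith
    then have "\<Phi> (y (s l)) m = x m"
      using y(2)[of "s l"] by (simp add: agree_def nat_le_iff)
    then show ?thesis
      using r[OF y(1) l(2)] by simp
  qed
  then have "\<Phi> z = x" by blast
  ultimately show "x \<in> \<Phi> ` Y" by (metis imageI)
qed

text \<open>A closed set is the intersection of its outer approximations \<open>C' l\<close>, and
  over a finite alphabet each of these is a finite union of cylinders.\<close>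

lemma pointwise_closed_sets:
  fixes B :: "'a set"
  assumes "finite B" and CB: "\<And>x i. x \<in> C \<Longrightarrow> x i \<in> B" and "pointwise_closed C"
  shows "C \<in> sets (Pi\<^sub>M UNIV (\<lambda>_::int. count_space B))"
proof -
  let ?M = "Pi\<^sub>M UNIV (\<lambda>_::int. count_space B)"
  define C' where "C' l = {x \<in> space ?M. \<exists>y\<in>C. \<forall>i\<in>{-int l..int l}. x i = y i}" for l
  have "C' l \<in> sets ?M" for l
  proof -
    have "(\<lambda>y. restrict y {-int l..int l}) ` C \<subseteq> (\<Pi>\<^sub>E i\<in>{-int l..int l}. B)"
      using CB by auto
    then have fin: "finite ((\<lambda>y. restrict y {-int l..int l}) ` C)"
      by (rule finite_subset) (use \<open>finite B\<close> in \<open>auto intro: finite_PiE\<close>)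
    have "{x \<in> space ?M. x i = v i} \<in> sets ?M" for v i
    proof -
      have "(\<lambda>x. x i) -` (B \<inter> {v i}) \<inter> space ?M \<in> sets ?M"
        by (rule measurable_sets[OF measurable_component_singleton]) auto
      also have "(\<lambda>x. x i) -` (B \<inter> {v i}) \<inter> space ?M = {x \<in> space ?M. x i = v i}"
        by (auto simp: space_PiM)
      finally show ?thesis .
    qed
    then have "{x \<in> space ?M. \<exists>v\<in>(\<lambda>y. restrict y {-int l..int l}) ` C. \<forall>i\<in>{-int l..int l}. x i = v i} \<in> sets ?M"
      by (intro sets.sets_Collect_finite_Ex[OF _ fin] sets.sets_Collect_finite_All') auto
    then show ?thesis
      by (simp add: C'_def)
  qed
  moreover have "C = (\<Inter>l. C' l)"
  proof
    show "C \<subseteq> (\<Inter>l. C' l)"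
      using CB by (auto simp: C'_def space_PiM)
    show "(\<Inter>l. C' l) \<subseteq> C"
    proof
      fix x assume x: "x \<in> (\<Inter>l. C' l)"
      have "\<exists>y\<in>C. agree r y x" for r
      proof -
        have "x \<in> C' (nat \<bar>r\<bar>)" using x by blast
        then obtain y where "y \<in> C" and y: "\<forall>i\<in>{-int (nat \<bar>r\<bar>)..int (nat \<bar>r\<bar>)}. x i = y i"
          unfolding C'_def by blast
        have "y i = x i" if "\<bar>i\<bar> \<le> r" for i
        proof -
          have "i \<in> {-int (nat \<bar>r\<bar>)..int (nat \<bar>r\<bar>)}" using that by simp linarith
          then show ?thesis using y by metis
        qed
        then show ?thesis using \<open>y \<in> C\<close> unfolding agree_def by blast
      qed
      then show "x \<in> C"
        using \<open>pointwise_closed C\<close> by (auto simp: pointwise_closed_def)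
    qed
  qed
  ultimately show ?thesis by auto
qed

lemma space_sequence_borel: "X \<subseteq> {x. \<forall>i. x i \<in> B} \<Longrightarrow> space (sequence_borel B X) = X"
  by (auto simp: sequence_borel_def space_restrict_space space_PiM)

lemma pointwise_closed_sequence_borel:
  assumes "finite B" and "X \<subseteq> {x. \<forall>i. x i \<in> B}" and "C \<subseteq> X" and "pointwise_closed C"
  shows "C \<in> sets (sequence_borel B X)"
proof -
  have "C \<in> sets (Pi\<^sub>M UNIV (\<lambda>_::int. count_space B))"
    by (rule pointwise_closed_sets) (use assms in auto)
  then show ?thesis
    using assms(3) by (auto simp: sequence_borel_def sets_restrict_space)
qed

section \<open>Floors of the towers\<close>

definition tower_level :: "(nat \<Rightarrow> 'a set) \<Rightarrow> (nat \<Rightarrow> 'a \<Rightarrow> 'a list) \<Rightarrow> nat \<Rightarrow> 'a \<Rightarrow> nat \<Rightarrow> (int \<Rightarrow> 'a) set" where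
  "tower_level A \<tau> n a k =
     (seq_shift ^^ k) ` morph_seq (comp_morph \<tau> 0 n) ` {x \<in> level_subshift A \<tau> n. x 0 = a}"

lemma tower_eq: "tower A \<tau> n a = (\<Union>k<tower_height \<tau> n a. tower_level A \<tau> n a k)"
  by (simp add: tower_def tower_level_def)

lemma tower_level_funpow: "(seq_shift ^^ k) ` tower_level A \<tau> n a 0 = tower_level A \<tau> n a k"
  by (simp add: tower_level_def)

lemma tower_level_subset:
  assumes "directive_sequence A \<tau>"
  shows "tower_level A \<tau> n a k \<subseteq> level_subshift A \<tau> 0"
  using level_subshift_translate[OF comp_morph_level_subshift[OF assms]]
  by (auto simp: tower_level_def seq_shift_funpow)

lemma tower_level_sets:
  assumes D: "directive_sequence A \<tau>"
  shows "tower_level A \<tau> n a k \<in> sets (sequence_borel (A 0) (level_subshift A \<tau> 0))"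
proof (rule pointwise_closed_sequence_borel)
  let ?\<sigma> = "comp_morph \<tau> 0 n" and ?Y = "{x \<in> level_subshift A \<tau> n. x 0 = a}"
  show "finite (A 0)" using directive_sequenceD(1)[OF D] .
  show "level_subshift A \<tau> 0 \<subseteq> {x. \<forall>i. x i \<in> A 0}"
    by (auto intro: level_subshift_letter)
  show "tower_level A \<tau> n a k \<subseteq> level_subshift A \<tau> 0"
    by (rule tower_level_subset[OF D])
  have "pointwise_closed ((\<lambda>x. (seq_shift ^^ k) (morph_seq ?\<sigma> x)) ` ?Y)"
  proof (rule pointwise_closed_image[where B = "A n"])
    show "finite (A n)" using directive_sequenceD(1)[OF D] .
    show "y i \<in> A n" if "y \<in> ?Y" for y i
      using that level_subshift_letter by fastforce
    show "pointwise_closed ?Y"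
      unfolding pointwise_closed_def
    proof safe
      fix x assume x: "\<forall>r. \<exists>y\<in>?Y. agree r y x"
      show "x \<in> level_subshift A \<tau> n"
      proof (rule level_subshift_closed)
        fix r
        from x obtain y where "y \<in> ?Y" "agree r y x" by blast
        then show "\<exists>y\<in>level_subshift A \<tau> n. \<forall>i. \<bar>i\<bar> \<le> r \<longrightarrow> y i = x i"
          by (auto simp: agree_def)
      qed
      show "x 0 = a"
        using x[rule_format, of 0] by (auto simp: agree_def)
    qed
    fix y m assume y: "y \<in> ?Y"
    have "?\<sigma> (y i) \<noteq> []" for i
      using comp_morph_level_nonempty[OF D, of y n] y by simp
    from morph_seq_local[of ?\<sigma> y "m + int k", OF this]
    obtain r where r: "\<forall>y'. (\<forall>i. ?\<sigma> (y' i) \<noteq> []) \<longrightarrow> (\<forall>i. \<bar>i\<bar> \<le> r \<longrightarrow> y' i = y i) \<longrightarrow>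
        morph_seq ?\<sigma> y' (m + int k) = morph_seq ?\<sigma> y (m + int k)"
      by (rule exE)
    show "\<exists>r. \<forall>y'\<in>?Y. agree r y' y \<longrightarrow>
        (seq_shift ^^ k) (morph_seq ?\<sigma> y') m = (seq_shift ^^ k) (morph_seq ?\<sigma> y) m"
    proof (intro exI ballI impI)
      fix y' assume y': "y' \<in> ?Y" "agree r y' y"
      have "?\<sigma> (y' i) \<noteq> []" for i
        using comp_morph_level_nonempty[OF D, of y' n] y' by simp
      with r y'(2)
      show "(seq_shift ^^ k) (morph_seq ?\<sigma> y') m = (seq_shift ^^ k) (morph_seq ?\<sigma> y) m"
        by (simp add: seq_shift_funpow agree_def)
    qed
  qed
  then show "pointwise_closed (tower_level A \<tau> n a k)"
    by (simp add: tower_level_def image_image)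
qed

text \<open>Different letters \<open>a\<close> and \<open>b\<close> are allowed because the floors
  that must be disjoint later are unions over several towers.\<close>

lemma tower_level_disjoint:
  assumes "directive_sequence A \<tau>" "recognizable A \<tau>"
    and "k < tower_height \<tau> n a" "l < tower_height \<tau> n b"
    and "y \<in> tower_level A \<tau> n a k" "y \<in> tower_level A \<tau> n b l"
  shows "k = l"
proof -
  let ?f = "morph_seq (comp_morph \<tau> 0 n)"
  obtain x where x: "x \<in> level_subshift A \<tau> n" "x 0 = a" "y = (seq_shift ^^ k) (?f x)"
    using assms(5) unfolding tower_level_def by blast
  obtain x' where x': "x' \<in> level_subshift A \<tau> n" "x' 0 = b" "y = (seq_shift ^^ l) (?f x')"
    using assms(6) unfolding tower_level_def by blast
  show ?thesis
    by (rule comp_morph_recognizable[OF assms(1,2) x(1) x'(1), THEN conjunct1])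
      (simp_all only: assms(3,4) x(2) x'(2) flip: x(3) x'(3))
qed

text \<open>Shifting the image of \<open>x\<close> past the block of \<open>x 0\<close> gives the
  image of the shifted \<open>x\<close>, so the new base is the one over \<open>x 1\<close>.\<close>

lemma tower_level_return:
  assumes D: "directive_sequence A \<tau>" and "y \<in> tower_level A \<tau> n a 0"
  shows "\<exists>b\<in>A n. (seq_shift ^^ tower_height \<tau> n a) y \<in> tower_level A \<tau> n b 0"
proof -
  let ?\<sigma> = "comp_morph \<tau> 0 n"
  obtain x where x: "x \<in> level_subshift A \<tau> n" "x 0 = a" "y = morph_seq ?\<sigma> x"
    using assms(2) by (auto simp: tower_level_def)
  have "?\<sigma> (x i) \<noteq> []" for i
    using comp_morph_level_nonempty[OF D x(1)] .
  from morph_seq_translate[of ?\<sigma> x 1, OF this]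
  have "(seq_shift ^^ tower_height \<tau> n a) y = morph_seq ?\<sigma> (\<lambda>i. x (i + 1))"
    using tower_height_eq_offset[of \<tau> n x] by (simp add: seq_shift_funpow x)
  moreover have "(\<lambda>i. x (i + 1)) \<in> {u \<in> level_subshift A \<tau> n. u 0 = x 1}"
    using level_subshift_translate[OF x(1), of 1] by simp
  ultimately have "(seq_shift ^^ tower_height \<tau> n a) y \<in> tower_level A \<tau> n (x 1) 0"
    unfolding tower_level_def by simp
  then show ?thesis
    using level_subshift_letter[OF x(1), of 1] by blast
qed

lemma tower_level_word:
  assumes D: "directive_sequence A \<tau>" and "y \<in> tower_level A \<tau> n a 0" "k < tower_height \<tau> n a"
  shows "y (int k) = comp_morph \<tau> 0 n a ! k"
proof -
  let ?\<sigma> = "comp_morph \<tau> 0 n"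
  obtain x where x: "x \<in> level_subshift A \<tau> n" "x 0 = a" "y = morph_seq ?\<sigma> x"
    using assms(2) by (auto simp: tower_level_def)
  have "?\<sigma> (x i) \<noteq> []" for i
    using comp_morph_level_nonempty[OF D x(1)] .
  moreover have "int k < offset ?\<sigma> x (0 + 1)"
    using tower_height_eq_offset[of \<tau> n x] assms(3) unfolding x(2) by simp
  moreover have "offset ?\<sigma> x 0 \<le> int k" by simp
  ultimately have "morph_seq ?\<sigma> x (int k) = ?\<sigma> (x 0) ! nat (int k - offset ?\<sigma> x 0)"
    using morph_seq_eq by metis
  then show ?thesis
    unfolding x(2,3) by simp
qed


section \<open>Eigenfunctions of measure preserving maps\<close>

locale measure_preserving = prob_space M for M :: "'x measure" +
  fixes T :: "'x \<Rightarrow> 'x"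
  assumes measurable_T: "T \<in> measurable M M" and distr_T: "distr M M T = M"
begin

lemma measurable_funpow_T [measurable]: "(T ^^ k) \<in> measurable M M"
proof (induction k)
  case (Suc k)
  then show ?case using measurable_comp[OF Suc measurable_T] by (simp add: comp_def)
qed (simp add: id_def)

lemma distr_funpow_T: "distr M M (T ^^ k) = M"
proof (induction k)
  case 0
  then show ?case using distr_id[of M] by (simp add: id_def)
next
  case (Suc k)
  then show ?case
    using distr_distr[OF measurable_T measurable_funpow_T[of k]] by (simp add: distr_T comp_def)
qed

lemma funpow_T_space: "x \<in> space M \<Longrightarrow> (T ^^ k) x \<in> space M"
  using measurable_space[OF measurable_funpow_T] .

lemma integral_funpow_T:
  fixes F :: "'x \<Rightarrow> real"
  assumes "F \<in> borel_measurable M"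
  shows "(\<integral>x. F ((T ^^ k) x) \<partial>M) = (\<integral>x. F x \<partial>M)"
  using integral_distr[OF measurable_funpow_T[of k] assms] by (simp add: distr_funpow_T)

lemma integrable_funpow_T:
  fixes F :: "'x \<Rightarrow> real"
  assumes "integrable M F"
  shows "integrable M (\<lambda>x. F ((T ^^ k) x))"
  using integrable_distr[OF measurable_funpow_T[of k], of F] assms by (simp add: distr_funpow_T)

lemma AE_funpow_T: "AE x in M. P x \<Longrightarrow> AE x in M. P ((T ^^ k) x)"
  using AE_distrD[OF measurable_funpow_T[of k], of P] unfolding distr_funpow_T .

lemma inj_on_funpow_T: "inj_on T (space M) \<Longrightarrow> inj_on (T ^^ k) (space M)"
proof (induction k)
  case (Suc k)
  then show ?case
    using funpow_T_space by (auto simp: inj_on_def)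
qed simp

text \<open>Injectivity makes \<open>B\<close> the full preimage of its image, to which invariance
  applies. Measurability of the image is a hypothesis, as the inverse map is not known to be
  measurable.\<close>

lemma measure_image_funpow_T:
  assumes "inj_on T (space M)" "B \<subseteq> space M" "(T ^^ k) ` B \<in> sets M"
  shows "measure M ((T ^^ k) ` B) = measure M B"
proof -
  have "(T ^^ k) -` ((T ^^ k) ` B) \<inter> space M = B"
    using inj_on_funpow_T[OF assms(1), of k] assms(2) by (auto dest: inj_onD)
  then show ?thesis
    using measure_distr[OF measurable_funpow_T[of k] assms(3)] by (simp add: distr_funpow_T)
qed

context
  fixes f :: "'x \<Rightarrow> complex" and z :: complex
  assumes f_int: "integrable M f" and z: "norm z = 1"
    and eigen: "AE x in M. f (T x) = z * f x"
begin

lemma f_meas [measurable]: "f \<in> borel_measurable M"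
  using f_int by auto

lemma eigen_funpow: "AE x in M. f ((T ^^ k) x) = z ^ k * f x"
proof (induction k)
  case (Suc k)
  then show ?case
    using AE_funpow_T[OF eigen, of k] by eventually_elim simp
qed simp

text \<open>Since |z| = 1, the modulus of \<open>f\<close> is invariant almost everywhere and its
  superlevel sets have probability 0 or 1. Those with thresholds 1/(n+1) exhaust the set where
  \<open>f\<close> does not vanish, so one of them has probability 1.\<close>

lemma eigenfunction_bounded_below:
  assumes ergodic: "\<And>B. B \<in> sets M \<Longrightarrow> T -` B \<inter> space M = B \<Longrightarrow> prob B = 0 \<or> prob B = 1"
    and nz: "\<not> (AE x in M. f x = 0)"
  obtains r where "r > 0" "AE x in M. r \<le> norm (f x)"
proof -
  define E where "E r = {x \<in> space M. r < norm (f x)}" for r :: real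
  have E_sets [measurable]: "E r \<in> sets M" for r
    unfolding E_def by measurable
  have zero_one: "prob (E r) = 0 \<or> prob (E r) = 1" for r
  proof -
    \<comment> \<open>\<open>E r\<close> is invariant only almost everywhere; the points eventually in \<open>E r\<close> form a strictly
      invariant set.\<close>
    define B where "B = {x \<in> space M. \<exists>m. \<forall>k\<ge>m. (T ^^ k) x \<in> E r}"
    have [measurable]: "B \<in> sets M"
      unfolding B_def by measurable
    have "T x \<in> B \<longleftrightarrow> x \<in> B" if x: "x \<in> space M" for x
    proof -
      have "(\<exists>m. \<forall>k\<ge>m. (T ^^ k) (T x) \<in> E r) \<longleftrightarrow> (\<exists>m. \<forall>k\<ge>m. (T ^^ Suc k) x \<in> E r)"
        by (simp add: funpow_swap1)
      also have "\<dots> \<longleftrightarrow> (\<exists>m. \<forall>k\<ge>m. (T ^^ k) x \<in> E r)"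
        using eventually_sequentially_Suc[of "\<lambda>k. (T ^^ k) x \<in> E r"]
        by (simp only: eventually_sequentially)
      finally show ?thesis
        using x funpow_T_space[of x 1] by (simp add: B_def)
    qed
    then have "T -` B \<inter> space M = B"
      by (auto simp: B_def)
    then have "prob B = 0 \<or> prob B = 1"
      using ergodic \<open>B \<in> sets M\<close> by blast
    moreover have "prob B = prob (E r)"
    proof (rule finite_measure_eq_AE)
      have "AE x in M. \<forall>k. f ((T ^^ k) x) = z ^ k * f x"
        using eigen_funpow by (simp add: AE_all_countable)
      then show "AE x in M. x \<in> B \<longleftrightarrow> x \<in> E r"
        using AE_space
      proof eventually_elim
        case (elim x)
        then have "norm (f ((T ^^ k) x)) = norm (f x)" for k
          using z by (simp add: norm_mult norm_power)
        then show ?case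
          using elim funpow_T_space by (auto simp: B_def E_def)
      qed
    qed auto
    ultimately show ?thesis by simp
  qed
  have "\<exists>n. prob (E (inverse (real (Suc n)))) = 1"
  proof (rule ccontr)
    assume "\<not> ?thesis"
    then have "AE x in M. x \<notin> E (inverse (real (Suc n)))" for n
      using zero_one prob_eq_0[OF E_sets] by blast
    then have "AE x in M. \<forall>n. x \<notin> E (inverse (real (Suc n)))"
      by (simp add: AE_all_countable)
    then have "AE x in M. f x = 0"
      using AE_space
    proof eventually_elim
      case (elim x)
      show ?case
      proof (rule ccontr)
        assume "f x \<noteq> 0"
        then obtain n where "inverse (real (Suc n)) < norm (f x)"
          using reals_Archimedean[of "norm (f x)"] by auto
        then show False using elim by (auto simp: E_def)
      qed
    qed
    with nz show False by blast
  qed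
  then obtain n where "AE x in M. x \<in> E (inverse (real (Suc n)))"
    using prob_eq_1[OF E_sets] by blast
  then have "AE x in M. inverse (real (Suc n)) \<le> norm (f x)"
    by eventually_elim (auto simp: E_def)
  then show thesis
    by (intro that[of "inverse (real (Suc n))"]) auto
qed

text \<open>Transport by \<open>T ^^ j\<close> turns the deviation of \<open>f\<close> from a
  constant on \<open>B\<close> into the deviation of \<open>f\<close> from \<open>g\<close> on floor
  \<open>j\<close>. The floors are disjoint, so these deviations add up to at most the L1 distance,
  and the smallest of them gains the factor \<open>card J\<close>.\<close>

lemma eigenfunction_nearly_constant:
  fixes g :: "'x \<Rightarrow> complex"
  assumes inj: "inj_on T (space M)" and g_int: "integrable M g"
    and B [measurable]: "B \<in> sets M" and J: "finite J" "J \<noteq> {}"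
    and levels: "\<And>j. j \<in> J \<Longrightarrow> (T ^^ j) ` B \<in> sets M"
    and disj: "disjoint_family_on (\<lambda>j. (T ^^ j) ` B) J"
    and const: "\<And>j x. j \<in> J \<Longrightarrow> x \<in> B \<Longrightarrow> g ((T ^^ j) x) = G j"
  shows "\<exists>w. real (card J) * (\<integral>x. indicator B x * norm (f x - w) \<partial>M) \<le> (\<integral>x. norm (f x - g x) \<partial>M)"
proof -
  have B_sub: "B \<subseteq> space M"
    using sets.sets_into_space[OF B] .
  have [measurable]: "g \<in> borel_measurable M" using g_int by auto
  \<comment> \<open>\<open>G j / z ^ j\<close> is the value \<open>f\<close> would have on
    \<open>B\<close> if it equalled \<open>g\<close> on floor \<open>j\<close>.\<close>
  define I where "I j = (\<integral>x. indicator B x * norm (f x - G j / z ^ j) \<partial>M)" for j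
  have z0: "z \<noteq> 0" using z by auto
  have I_eq: "I j = (\<integral>x. indicator ((T ^^ j) ` B) x * norm (f x - g x) \<partial>M)" if j: "j \<in> J" for j
  proof -
    have "I j = (\<integral>x. indicator ((T ^^ j) ` B) ((T ^^ j) x) * norm (f ((T ^^ j) x) - g ((T ^^ j) x)) \<partial>M)"
      unfolding I_def
    proof (rule integral_cong_AE)
      show "AE x in M. indicator B x * norm (f x - G j / z ^ j) =
        indicator ((T ^^ j) ` B) ((T ^^ j) x) * norm (f ((T ^^ j) x) - g ((T ^^ j) x))"
        using eigen_funpow[of j] AE_space
      proof eventually_elim
        case (elim x)
        have "(T ^^ j) x \<in> (T ^^ j) ` B \<longleftrightarrow> x \<in> B"
          using inj_on_funpow_T[OF inj, of j] B_sub elim(2) by (auto dest: inj_onD)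
        moreover have "norm (z ^ j * f x - G j) = norm (f x - G j / z ^ j)"
        proof -
          have "z ^ j * f x - G j = z ^ j * (f x - G j / z ^ j)"
            using z0 by (simp add: field_simps)
          then show ?thesis using z by (simp add: norm_mult norm_power)
        qed
        ultimately show ?case
          using const[OF j, of x] elim(1) by (auto simp: indicator_def)
      qed
    qed (use levels[OF j] in measurable)
    also have "\<dots> = (\<integral>x. indicator ((T ^^ j) ` B) x * norm (f x - g x) \<partial>M)"
      by (rule integral_funpow_T) (use levels[OF j] in measurable)
    finally show ?thesis .
  qed
  have fg: "integrable M (\<lambda>x. norm (f x - g x))"
    using f_int g_int by auto
  have fgj: "integrable M (\<lambda>x. indicator ((T ^^ j) ` B) x * norm (f x - g x))" if "j \<in> J" for j
    using integrable_mult_indicator[OF levels[OF that] fg] by simp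
  have "(\<Sum>j\<in>J. I j) = (\<integral>x. (\<Sum>j\<in>J. indicator ((T ^^ j) ` B) x * norm (f x - g x)) \<partial>M)"
    using fgj by (simp add: I_eq)
  also have "\<dots> \<le> (\<integral>x. norm (f x - g x) \<partial>M)"
  proof (rule integral_mono)
    fix x
    have "(\<Sum>j\<in>J. indicator ((T ^^ j) ` B) x * norm (f x - g x)) =
        indicator (\<Union>j\<in>J. (T ^^ j) ` B) x * norm (f x - g x)"
      by (simp add: indicator_UN_disjoint[OF J(1) disj] sum_distrib_right)
    also have "\<dots> \<le> norm (f x - g x)"
      by (simp add: indicator_def)
    finally show "(\<Sum>j\<in>J. indicator ((T ^^ j) ` B) x * norm (f x - g x)) \<le> norm (f x - g x)" .
  qed (use fg fgj in auto)
  finally have sum: "(\<Sum>j\<in>J. I j) \<le> (\<integral>x. norm (f x - g x) \<partial>M)" .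
  obtain j where j: "j \<in> J" "\<And>i. i \<in> J \<Longrightarrow> I j \<le> I i"
    using ex_min_if_finite[of "I ` J"] J by (auto simp: not_less)
  have "real (card J) * I j \<le> (\<Sum>j\<in>J. I j)"
    using sum_bounded_below[of J "I j" I] j by simp
  with sum show ?thesis
    unfolding I_def by (intro exI[of _ "G j / z ^ j"]) simp
qed

text \<open>For \<open>x\<close> in \<open>C\<close> both \<open>x\<close> and
  \<open>(T ^^ h) x\<close> lie in \<open>B\<close>, so (z^h - 1) * f x is a difference of two
  deviations of \<open>f\<close> from the same \<open>w\<close>. By invariance both have the same
  integral, whence the factor 2.\<close>

lemma eigenvalue_return_time:
  assumes B [measurable]: "B \<in> sets M" "C \<in> sets M" and CB: "C \<subseteq> B"
    and ret: "\<And>x. x \<in> C \<Longrightarrow> (T ^^ h) x \<in> B"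
    and low: "AE x in M. r \<le> norm (f x)"
  shows "norm (z ^ h - 1) * r * prob C \<le> 2 * (\<integral>x. indicator B x * norm (f x - w) \<partial>M)"
proof -
  define F where "F x = indicator B x * norm (f x - w)" for x
  have F_int: "integrable M F"
    using integrable_mult_indicator[OF B(1), of "\<lambda>x. norm (f x - w)"] f_int by (simp add: F_def[abs_def])
  have "norm (z ^ h - 1) * r * prob C = (\<integral>x. norm (z ^ h - 1) * r * indicator C x \<partial>M)"
    by (simp add: mult.commute)
  also have "\<dots> \<le> (\<integral>x. F ((T ^^ h) x) + F x \<partial>M)"
  proof (rule integral_mono_AE)
    show "integrable M (\<lambda>x. F ((T ^^ h) x) + F x)"
      using F_int integrable_funpow_T[OF F_int] by auto
    show "integrable M (\<lambda>x. norm (z ^ h - 1) * r * indicator C x)"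
      by (intro integrable_mult_right) (auto simp: emeasure_eq_measure)
    show "AE x in M. norm (z ^ h - 1) * r * indicator C x \<le> F ((T ^^ h) x) + F x"
      using eigen_funpow[of h] low
    proof eventually_elim
      case (elim x)
      show ?case
      proof (cases "x \<in> C")
        case True
        have "norm (z ^ h - 1) * r \<le> norm (z ^ h - 1) * norm (f x)"
          using elim by (intro mult_left_mono) auto
        also have "\<dots> = norm ((z ^ h * f x - w) - (f x - w))"
          by (simp add: algebra_simps flip: norm_mult)
        also have "\<dots> \<le> norm (z ^ h * f x - w) + norm (f x - w)"
          by (rule norm_triangle_ineq4)
        finally show ?thesis
          using True CB ret[OF True] elim by (auto simp: F_def)
      qed (auto simp: F_def)
    qed
  qed
  also have "\<dots> = 2 * (\<integral>x. F x \<partial>M)"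
    using F_int integrable_funpow_T[OF F_int, of h] integral_funpow_T[of F h] by simp
  finally show ?thesis by (simp add: F_def)
qed

end

end


section \<open>Approximation by functions of finitely many coordinates\<close>

context
  fixes B :: "'a set" and X :: "(int \<Rightarrow> 'a) set" and M :: "(int \<Rightarrow> 'a) measure"
  assumes XB: "X \<subseteq> {x. \<forall>i. x i \<in> B}" and sets_M: "sets M = sets (sequence_borel B X)"
    and fin_M: "finite_measure M"
begin

interpretation finite_measure M by (rule fin_M)

lemma space_eq_sequences: "space M = X"
  using sets_eq_imp_space_eq[OF sets_M] space_sequence_borel[OF XB] by simp

text \<open>Induction on the generation of the product sigma-algebra by single coordinates. The set
  \<open>D\<close> varies in the full product and only its trace on \<open>X\<close> is
  approximated, because the measure lives on \<open>X\<close>.\<close>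

lemma cylinder_set_approx:
  assumes "E \<in> sets M" "\<epsilon> > 0"
  shows "\<exists>m F. F \<in> sets M \<and> (\<forall>x\<in>X. \<forall>y\<in>X. agree m x y \<longrightarrow> (x \<in> F \<longleftrightarrow> y \<in> F)) \<and>
    measure M (sym_diff E F) < \<epsilon>"
proof -
  let ?\<Omega> = "\<Pi>\<^sub>E i\<in>(UNIV :: int set). space (count_space B)"
  let ?G = "{{f \<in> ?\<Omega>. f i \<in> A} |i A. i \<in> UNIV \<and> A \<in> sets (count_space B)}"
  have sets: "X \<inter> D \<in> sets M" if "D \<in> sigma_sets ?\<Omega> ?G" for D
    using that sets_PiM_single[of UNIV "\<lambda>_::int. count_space B"]
    by (auto simp: sets_M sequence_borel_def sets_restrict_space)
  obtain D where D: "D \<in> sigma_sets ?\<Omega> ?G" "E = X \<inter> D"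
    using assms(1) sets_PiM_single[of UNIV "\<lambda>_::int. count_space B"]
    by (auto simp: sets_M sequence_borel_def sets_restrict_space)
  show ?thesis
    using D(1) assms(2) unfolding D(2)
  proof (induction arbitrary: \<epsilon>)
    case (Basic D)
    then obtain i A where D: "D = {f \<in> ?\<Omega>. f i \<in> A}" by blast
    have "X \<inter> D \<in> sets M"
      using sets sigma_sets.Basic[OF Basic(1)] by blast
    moreover have "x \<in> X \<inter> D \<longleftrightarrow> y \<in> X \<inter> D" if "x \<in> X" "y \<in> X" "agree \<bar>i\<bar> x y" for x y
      using that XB by (auto simp: D agree_def)
    ultimately show ?case
      using Basic(2) by (intro exI[of _ "\<bar>i\<bar>"] exI[of _ "X \<inter> D"]) auto
  next
    case Empty
    then show ?case by (intro exI[of _ 0] exI[of _ "{}"]) auto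
  next
    case (Compl D)
    obtain m F where F: "F \<in> sets M" "\<forall>x\<in>X. \<forall>y\<in>X. agree m x y \<longrightarrow> (x \<in> F \<longleftrightarrow> y \<in> F)"
      "measure M (sym_diff (X \<inter> D) F) < \<epsilon>"
      using Compl.IH[OF Compl.prems] by blast
    have "sym_diff (X \<inter> (?\<Omega> - D)) (X - F) = sym_diff (X \<inter> D) F"
      using XB sets.sets_into_space[OF F(1)] by (auto simp: space_eq_sequences)
    moreover have "X - F \<in> sets M"
      using sets.compl_sets[OF F(1)] by (simp add: space_eq_sequences)
    moreover have "\<forall>x\<in>X. \<forall>y\<in>X. agree m x y \<longrightarrow> (x \<in> X - F \<longleftrightarrow> y \<in> X - F)"
      using F(2) by blast
    ultimately show ?case
      using F(3) by (intro exI[of _ m] exI[of _ "X - F"]) metis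
  next
    case (Union D)
    let ?U = "\<lambda>N. \<Union>i<N. X \<inter> D i"
    have XD [measurable]: "X \<inter> D i \<in> sets M" for i
      by (rule sets[OF Union.hyps])
    have "(\<lambda>N. measure M (?U N)) \<longlonglongrightarrow> measure M (\<Union>N. ?U N)"
    proof (rule finite_Lim_measure_incseq)
      show "range ?U \<subseteq> sets M" using XD by blast
      show "incseq ?U" unfolding incseq_def by force
    qed
    also have "(\<Union>N. ?U N) = X \<inter> (\<Union>i. D i)" by auto
    finally have lim: "(\<lambda>N. measure M (?U N)) \<longlonglongrightarrow> measure M (X \<inter> (\<Union>i. D i))" .
    have "\<forall>\<^sub>F N in sequentially. \<bar>measure M (?U N) - measure M (X \<inter> (\<Union>i. D i))\<bar> < \<epsilon> / 2"
      using tendstoD[OF lim, of "\<epsilon> / 2"] Union.prems by (simp add: dist_real_def)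
    from eventually_happens'[OF sequentially_bot this] obtain N where N: "\<bar>measure M (?U N) - measure M (X \<inter> (\<Union>i. D i))\<bar> < \<epsilon> / 2"
      by blast
    have XU: "X \<inter> (\<Union>i. D i) \<in> sets M"
      by (rule sets[OF sigma_sets.Union[OF Union.hyps]])
    have UN: "?U N \<in> sets M" by (intro sets.finite_UN XD) auto
    have N': "measure M (X \<inter> (\<Union>i. D i) - ?U N) < \<epsilon> / 2"
    proof -
      have "?U N \<subseteq> X \<inter> (\<Union>i. D i)" by blast
      from finite_measure_Diff[OF XU UN this] show ?thesis using N by linarith
    qed
    \<comment> \<open>Half of \<epsilon> pays for truncating the union, half for \<open>N\<close>
      approximations; \<open>Suc N\<close> avoids division by zero when
      \<open>N = 0\<close>.\<close>
    define \<eta> where "\<eta> = \<epsilon> / (2 * real (Suc N))"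
    have "\<eta> > 0" using Union.prems by (simp add: \<eta>_def)
    then have "\<forall>i. \<exists>m F. F \<in> sets M \<and> (\<forall>x\<in>X. \<forall>y\<in>X. agree m x y \<longrightarrow> (x \<in> F \<longleftrightarrow> y \<in> F)) \<and>
        measure M (sym_diff (X \<inter> D i) F) < \<eta>"
      using Union.IH by blast
    then obtain m F where F [measurable]: "\<And>i. F i \<in> sets M"
      and Fm: "\<And>i x y. x \<in> X \<Longrightarrow> y \<in> X \<Longrightarrow> agree (m i) x y \<Longrightarrow> x \<in> F i \<longleftrightarrow> y \<in> F i"
      and F\<eta>: "\<And>i. measure M (sym_diff (X \<inter> D i) (F i)) < \<eta>"
      by metis
    let ?F = "\<Union>i<N. F i"
    have SD: "sym_diff (X \<inter> D i) (F i) \<in> sets M" for i by auto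
    have "measure M (sym_diff (X \<inter> (\<Union>i. D i)) ?F) \<le>
        measure M ((X \<inter> (\<Union>i. D i) - ?U N) \<union> (\<Union>i<N. sym_diff (X \<inter> D i) (F i)))"
      using XU UN SD by (intro finite_measure_mono sets.Un sets.Diff sets.finite_UN) auto
    also have "\<dots> \<le> measure M (X \<inter> (\<Union>i. D i) - ?U N) + measure M (\<Union>i<N. sym_diff (X \<inter> D i) (F i))"
      using XU UN SD by (intro measure_Un_le sets.Diff sets.finite_UN) auto
    also have "measure M (\<Union>i<N. sym_diff (X \<inter> D i) (F i)) \<le>
        (\<Sum>i<N. measure M (sym_diff (X \<inter> D i) (F i)))"
      using SD by (intro finite_measure_subadditive_finite) auto
    also have "\<dots> \<le> (\<Sum>i<N. \<eta>)"
      using F\<eta> by (intro sum_mono less_imp_le)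
    also have "\<dots> \<le> \<epsilon> / 2"
      using Union.prems by (simp add: \<eta>_def field_simps)
    finally have "measure M (sym_diff (X \<inter> (\<Union>i. D i)) ?F) < \<epsilon>"
      using N' by simp
    moreover have "x \<in> ?F \<longleftrightarrow> y \<in> ?F"
      if "x \<in> X" "y \<in> X" "agree (\<Sum>i<N. \<bar>m i\<bar>) x y" for x y
    proof -
      have "agree (m i) x y" if "i < N" for i
      proof (rule agree_mono)
        show "m i \<le> (\<Sum>i<N. \<bar>m i\<bar>)"
          using member_le_sum[of i "{..<N}" "\<lambda>i. \<bar>m i\<bar>"] that by auto
      qed fact
      then show ?thesis
        using Fm[OF \<open>x \<in> X\<close> \<open>y \<in> X\<close>] by blast
    qed
    moreover have "?F \<in> sets M" by auto
    ultimately show ?case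
      by (intro exI[of _ "\<Sum>i<N. \<bar>m i\<bar>"] exI[of _ ?F]) simp
  qed
qed

text \<open>Induction on integrable functions: indicators come from
  \<open>cylinder_set_approx\<close>, sums enlarge the window, limits use dominated
  convergence.\<close>

lemma cylinder_function_approx:
  fixes f :: "(int \<Rightarrow> 'a) \<Rightarrow> complex"
  assumes "integrable M f" "\<epsilon> > 0"
  shows "\<exists>m g. integrable M g \<and> (\<forall>x\<in>X. \<forall>y\<in>X. agree m x y \<longrightarrow> g x = g y) \<and>
    (\<integral>x. norm (f x - g x) \<partial>M) < \<epsilon>"
  using assms
proof (induction arbitrary: \<epsilon>)
  case (base E c)
  \<comment> \<open>The summand 1 covers \<open>c = 0\<close>.\<close>
  define \<eta> where "\<eta> = \<epsilon> / (norm c + 1)"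
  have c: "norm c + 1 > 0" by (simp add: add_nonneg_pos)
  then have "\<eta> > 0" using base by (simp add: \<eta>_def)
  then obtain m F where F: "F \<in> sets M" "\<forall>x\<in>X. \<forall>y\<in>X. agree m x y \<longrightarrow> (x \<in> F \<longleftrightarrow> y \<in> F)"
      "measure M (sym_diff E F) < \<eta>"
    using cylinder_set_approx[OF base(1)] by metis
  have "(\<integral>x. norm (indicator E x *\<^sub>R c - indicator F x *\<^sub>R c) \<partial>M) =
      (\<integral>x. norm c * indicator (sym_diff E F) x \<partial>M)"
    by (intro Bochner_Integration.integral_cong) (auto simp: indicator_def)
  also have "\<dots> = norm c * measure M (sym_diff E F)"
    using base(1) F(1) sets.sets_into_space[of E M] sets.sets_into_space[of F M]
    by (auto simp: Int_absorb1 Int_absorb2)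
  also have "\<dots> \<le> norm c * \<eta>"
    using F(3) by (intro mult_left_mono) auto
  also have "\<dots> < \<epsilon>"
    using base(3) c by (simp add: \<eta>_def field_simps)
  finally have "(\<integral>x. norm (indicator E x *\<^sub>R c - indicator F x *\<^sub>R c) \<partial>M) < \<epsilon>" .
  moreover have "integrable M (\<lambda>x. indicator F x *\<^sub>R c)"
    using F(1) by (auto simp: emeasure_eq_measure)
  ultimately show ?case
    using F(2) by (intro exI[of _ m] exI[of _ "\<lambda>x. indicator F x *\<^sub>R c"]) (auto simp: indicator_def)
next
  case (add f f')
  obtain m g where g: "integrable M g" "\<forall>x\<in>X. \<forall>y\<in>X. agree m x y \<longrightarrow> g x = g y"
      "(\<integral>x. norm (f x - g x) \<partial>M) < \<epsilon> / 2"
    using add.IH(1)[of "\<epsilon> / 2"] add.prems by auto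
  obtain m' g' where g': "integrable M g'" "\<forall>x\<in>X. \<forall>y\<in>X. agree m' x y \<longrightarrow> g' x = g' y"
      "(\<integral>x. norm (f' x - g' x) \<partial>M) < \<epsilon> / 2"
    using add.IH(2)[of "\<epsilon> / 2"] add.prems by auto
  note int = \<open>integrable M f\<close> \<open>integrable M f'\<close> g(1) g'(1)
  have "(\<integral>x. norm (f x + f' x - (g x + g' x)) \<partial>M) \<le> (\<integral>x. norm (f x - g x) + norm (f' x - g' x) \<partial>M)"
    using int by (intro integral_mono) (auto simp: add_diff_add norm_triangle_ineq)
  also have "\<dots> = (\<integral>x. norm (f x - g x) \<partial>M) + (\<integral>x. norm (f' x - g' x) \<partial>M)"
    using int by (intro Bochner_Integration.integral_add) auto
  finally have "(\<integral>x. norm (f x + f' x - (g x + g' x)) \<partial>M) < \<epsilon>"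
    using g(3) g'(3) by simp
  moreover have "g x + g' x = g y + g' y" if "x \<in> X" "y \<in> X" "agree (max m m') x y" for x y
    using g(2) g'(2) that agree_mono[OF that(3)] by fastforce
  ultimately show ?case
    using g(1) g'(1) by (intro exI[of _ "max m m'"] exI[of _ "\<lambda>x. g x + g' x"]) auto
next
  case (lim f s)
  have int: "integrable M (\<lambda>x. norm (f x - s i x))" for i
    using lim by auto
  have "(\<lambda>i. \<integral>x. norm (f x - s i x) \<partial>M) \<longlonglongrightarrow> (\<integral>x. 0 \<partial>M)"
  \<comment> \<open>The approximants satisfy |s i x| \<le> 2 |f x|, hence the dominating function 3
    |f|.\<close>
  proof (rule integral_dominated_convergence[where w = "\<lambda>x. 3 * norm (f x)"])
    show "AE x in M. (\<lambda>i. norm (f x - s i x)) \<longlonglongrightarrow> 0"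
    proof (rule AE_I2)
      fix x assume "x \<in> space M"
      from tendsto_norm[OF tendsto_diff[OF tendsto_const lim.hyps(2)[OF this], of "f x"]]
      show "(\<lambda>i. norm (f x - s i x)) \<longlonglongrightarrow> 0" by simp
    qed
    show "AE x in M. norm (norm (f x - s i x)) \<le> 3 * norm (f x)" for i
    proof (rule AE_I2)
      fix x assume "x \<in> space M"
      then show "norm (norm (f x - s i x)) \<le> 3 * norm (f x)"
        using lim.hyps(3)[of x i] norm_triangle_ineq4[of "f x" "s i x"] by simp
    qed
  qed (use lim int in auto)
  then have "\<forall>\<^sub>F i in sequentially. (\<integral>x. norm (f x - s i x) \<partial>M) < \<epsilon> / 2"
    using lim.prems by (intro order_tendstoD) auto
  from eventually_happens'[OF sequentially_bot this] obtain i where i: "(\<integral>x. norm (f x - s i x) \<partial>M) < \<epsilon> / 2"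
    by blast
  obtain m g where g: "integrable M g" "\<forall>x\<in>X. \<forall>y\<in>X. agree m x y \<longrightarrow> g x = g y"
      "(\<integral>x. norm (s i x - g x) \<partial>M) < \<epsilon> / 2"
    using lim.IH[where i = i and \<epsilon> = "\<epsilon> / 2"] lim.prems by auto
  have int': "integrable M (\<lambda>x. norm (s i x - g x))" "integrable M (\<lambda>x. norm (f x - g x))"
    using lim g(1) by auto
  have "(\<integral>x. norm (f x - g x) \<partial>M) \<le> (\<integral>x. norm (f x - s i x) + norm (s i x - g x) \<partial>M)"
    using int[of i] int' norm_triangle_ineq[of "f x - s i x" "s i x - g x" for x]
    by (intro integral_mono) auto
  also have "\<dots> = (\<integral>x. norm (f x - s i x) \<partial>M) + (\<integral>x. norm (s i x - g x) \<partial>M)"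
    using int[of i] int' by (intro Bochner_Integration.integral_add) auto
  finally have "(\<integral>x. norm (f x - g x) \<partial>M) < \<epsilon>"
    using i g(3) by simp
  with g show ?case by blast
qed

end


section \<open>Tower heights and eigenvalues\<close>

lemma inj_seq_shift: "inj_on (seq_shift :: (int \<Rightarrow> 'a) \<Rightarrow> _) S"
proof (rule inj_onI)
  fix x y :: "int \<Rightarrow> 'a"
  assume "seq_shift x = seq_shift y"
  from fun_cong[OF this] have "x (i - 1 + 1) = y (i - 1 + 1)" for i
    unfolding seq_shift_def .
  then show "x = y" by auto
qed

section \<open>Growth of the tower heights\<close>

lemma tower_height_pos:
  assumes "directive_sequence A \<tau>" "a \<in> A n"
  shows "0 < tower_height \<tau> n a"
  using comp_morph_nonempty[OF assms(1) _ assms(2), of 0] by (simp add: tower_height_def)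

lemma min_length_le: "finite S \<Longrightarrow> a \<in> S \<Longrightarrow> min_length S \<sigma> \<le> length (\<sigma> a)"
  and max_length_ge: "finite S \<Longrightarrow> a \<in> S \<Longrightarrow> length (\<sigma> a) \<le> max_length S \<sigma>"
  by (simp_all add: min_length_def max_length_def)

lemma min_length_attained:
  assumes "finite S" "S \<noteq> {}"
  obtains a where "a \<in> S" "min_length S \<sigma> = length (\<sigma> a)"
proof -
  have "min_length S \<sigma> \<in> (\<lambda>a. length (\<sigma> a)) ` S"
    unfolding min_length_def using assms by (intro Min_in) auto
  then show thesis using that by blast
qed

lemma length_le_morph_word: "b \<in> set w \<Longrightarrow> length (\<sigma> b) \<le> length (morph_word \<sigma> w)"
  by (induction w) auto

text \<open>The image of \<open>a\<close> contains the image of every letter of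
  \<open>\<tau> N a\<close>; following first letters down to level \<open>n\<close> never increases
  the height.\<close>

lemma tower_height_descend:
  assumes D: "directive_sequence A \<tau>" and "n \<le> N" "a \<in> A N"
  shows "\<exists>b\<in>A n. tower_height \<tau> n b \<le> tower_height \<tau> N a"
  using assms(2,3)
proof (induction N arbitrary: a rule: dec_induct)
  case (step N)
  have b: "hd (\<tau> N a) \<in> set (\<tau> N a)" "hd (\<tau> N a) \<in> A N"
    using directive_sequenceD(2,3)[OF D step.prems] hd_in_set by blast+
  then have "tower_height \<tau> N (hd (\<tau> N a)) \<le> tower_height \<tau> (Suc N) a"
    by (simp add: tower_height_def comp_morph_Suc length_le_morph_word)
  then show ?case
    using step.IH[OF b(2)] by (meson le_trans)
qed auto

lemma tower_height_unbounded:
  assumes D: "directive_sequence A \<tau>" and x: "x \<in> level_subshift A \<tau> 0"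
  shows "\<exists>N>n. \<exists>a\<in>A N. l \<le> tower_height \<tau> N a"
proof -
  \<comment> \<open>\<open>s\<close> dominates every height up to level \<open>n\<close>, so a word
    longer than \<open>s\<close> can only come from a later level.\<close>
  define s where "s = (\<Sum>N\<le>n. \<Sum>a\<in>A N. tower_height \<tau> N a)"
  obtain N a where N: "a \<in> A N" "sublist (window x 0 (max l (Suc s))) (comp_morph \<tau> 0 N a)"
    using x unfolding level_subshift_iff by blast
  then have h: "max l (Suc s) \<le> tower_height \<tau> N a"
    using sublist_length_le[OF N(2)] by (simp add: tower_height_def)
  have "n < N"
  proof (rule ccontr)
    assume "\<not> n < N"
    then have "(\<Sum>a\<in>A N. tower_height \<tau> N a) \<le> s"
      unfolding s_def by (intro member_le_sum) auto
    moreover have "tower_height \<tau> N a \<le> (\<Sum>a\<in>A N. tower_height \<tau> N a)"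
      using N(1) directive_sequenceD(1)[OF D] by (intro member_le_sum) auto
    ultimately show False using h by simp
  qed
  then show ?thesis using h N(1) by auto
qed

text \<open>A point yields a letter at some later level, and descending from it produces one at
  level \<open>n\<close>.\<close>

lemma alphabet_nonempty:
  assumes D: "directive_sequence A \<tau>" and x: "x \<in> level_subshift A \<tau> 0"
  shows "A n \<noteq> {}"
  using tower_height_unbounded[OF D x, of n] tower_height_descend[OF D, of n] by (metis empty_iff less_imp_le)

text \<open>One tall tower at a late level makes all towers of that level tall by the ratio bound;
  by \<open>tower_height_descend\<close> the least height never drops afterwards.\<close>

lemma min_tower_height_at_top:
  assumes D: "directive_sequence A \<tau>" and x: "x \<in> level_subshift A \<tau> 0"
    and K: "\<forall>\<^sub>F n in sequentially.
      real (max_length (A n) (comp_morph \<tau> 0 n)) / real (min_length (A n) (comp_morph \<tau> 0 n)) \<le> K"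
  shows "filterlim (\<lambda>n. real (min_length (A n) (comp_morph \<tau> 0 n))) at_top sequentially"
  unfolding filterlim_at_top
proof
  fix R :: real
  obtain n\<^sub>1 where n\<^sub>1: "\<And>n. n \<ge> n\<^sub>1 \<Longrightarrow>
      real (max_length (A n) (comp_morph \<tau> 0 n)) / real (min_length (A n) (comp_morph \<tau> 0 n)) \<le> K"
    using K unfolding eventually_sequentially by blast
  note fin = directive_sequenceD(1)[OF D]
  \<comment> \<open>Chosen so that l \<le> K * ?m N forces ?m N above |R|; absolute values because
    neither sign is known.\<close>
  obtain l where l: "\<bar>K\<bar> * \<bar>R\<bar> < real l"
    using reals_Archimedean2 by blast
  obtain N a where N: "N > n\<^sub>1" "a \<in> A N" "l \<le> tower_height \<tau> N a"
    using tower_height_unbounded[OF D x] by blast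
  let ?m = "\<lambda>n. min_length (A n) (comp_morph \<tau> 0 n)"
  have m_eq: "\<exists>a\<in>A n. ?m n = tower_height \<tau> n a" for n
    using min_length_attained[OF fin alphabet_nonempty[OF D x]] by (metis tower_height_def)
  then have pos: "?m n > 0" for n
    using tower_height_pos[OF D] by metis
  have "real l \<le> real (max_length (A N) (comp_morph \<tau> 0 N))"
    using N max_length_ge[OF fin N(2), of "comp_morph \<tau> 0 N"] by (simp add: tower_height_def)
  also have "\<dots> \<le> K * real (?m N)"
    using n\<^sub>1[of N] N(1) pos[of N] by (simp add: pos_divide_le_eq)
  also have "\<dots> \<le> \<bar>K\<bar> * real (?m N)"
    by (intro mult_right_mono) auto
  finally have "\<bar>K\<bar> * \<bar>R\<bar> < \<bar>K\<bar> * real (?m N)" using l by simp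
  then have R: "R \<le> real (?m N)"
    using mult_left_mono[of "real (?m N)" "\<bar>R\<bar>" "\<bar>K\<bar>"] by linarith
  have "R \<le> real (?m n)" if n: "n \<ge> N" for n
  proof -
    obtain b where "b \<in> A n" "?m n = tower_height \<tau> n b" using m_eq by blast
    moreover from this obtain b' where "b' \<in> A N" "tower_height \<tau> N b' \<le> ?m n"
      using tower_height_descend[OF D n] by metis
    moreover have "?m N \<le> tower_height \<tau> N b'"
      unfolding tower_height_def by (rule min_length_le[OF fin]) fact
    ultimately show ?thesis using R by linarith
  qed
  then show "\<forall>\<^sub>F n in sequentially. R \<le> real (?m n)"
    unfolding eventually_sequentially by blast
qed

lemma nth_segment:
  assumes "c \<le> k" "k < d" "d \<le> length w"
  shows "w ! k = segment w c d ! (k - c)"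
  using assms by (simp add: segment_def)

lemma length_segment: "d \<le> length w \<Longrightarrow> length (segment w c d) = d - c"
  by (simp add: segment_def)

section \<open>Distance to the integers through the logarithm\<close>

lemma infdist_Ints_le:
  fixes t :: real
  shows "infdist t \<int> \<le> \<bar>Im (Ln (exp (2 * complex_of_real pi * \<i> * complex_of_real t)))\<bar> / (2 * pi)"
proof -
  let ?w = "exp (2 * complex_of_real pi * \<i> * complex_of_real t)"
  have "exp (2 * complex_of_real pi * \<i> * complex_of_real t) = exp (Ln ?w)" by simp
  \<comment> \<open>\<open>Ln\<close> inverts \<open>exp\<close> up to a multiple of 2 pi i; that
    multiple is the integer compared with \<open>t\<close>.\<close>
  then obtain k :: int where "2 * complex_of_real pi * \<i> * complex_of_real t = Ln ?w + of_real (of_int (2 * k) * pi) * \<i>"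
    unfolding exp_eq by blast
  from arg_cong[OF this, of Im] have "2 * pi * t = Im (Ln ?w) + 2 * real_of_int k * pi"
    by simp
  then have "t - real_of_int k = Im (Ln ?w) / (2 * pi)"
    by (simp add: field_simps)
  then have "dist t (of_int k) = \<bar>Im (Ln ?w)\<bar> / (2 * pi)"
    by (simp add: dist_real_def)
  moreover have "infdist t \<int> \<le> dist t (of_int k)"
    by (rule infdist_le) simp
  ultimately show ?thesis by simp
qed

lemma infdist_Ints_tendsto_0:
  fixes t :: "nat \<Rightarrow> real"
  assumes "(\<lambda>n. exp (2 * complex_of_real pi * \<i> * complex_of_real (t n))) \<longlonglongrightarrow> 1"
  shows "(\<lambda>n. infdist (t n) \<int>) \<longlonglongrightarrow> 0"
proof -
  have "(\<lambda>n. \<bar>Im (Ln (exp (2 * complex_of_real pi * \<i> * complex_of_real (t n))))\<bar> / (2 * pi))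
      \<longlonglongrightarrow> \<bar>Im (Ln 1)\<bar> / (2 * pi)"
    by (intro tendsto_intros assms) auto
  then have lim: "(\<lambda>n. \<bar>Im (Ln (exp (2 * complex_of_real pi * \<i> * complex_of_real (t n))))\<bar> / (2 * pi))
      \<longlonglongrightarrow> 0" by simp
  show ?thesis
    by (rule tendsto_sandwich[OF _ _ tendsto_const lim])
      (auto intro!: always_eventually infdist_Ints_le infdist_nonneg)
qed

section \<open>Estimates on the tower bases\<close>

definition tower_bases :: "(nat \<Rightarrow> 'a set) \<Rightarrow> (nat \<Rightarrow> 'a \<Rightarrow> 'a list) \<Rightarrow> nat \<Rightarrow> 'a set \<Rightarrow> (int \<Rightarrow> 'a) set" where
  "tower_bases A \<tau> n S = (\<Union>b\<in>S. tower_level A \<tau> n b 0)"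

context
  fixes A :: "nat \<Rightarrow> 'a set" and \<tau> :: "nat \<Rightarrow> 'a \<Rightarrow> 'a list" and \<mu> :: "(int \<Rightarrow> 'a) measure"
  assumes D: "directive_sequence A \<tau>" and R: "recognizable A \<tau>"
    and sets_\<mu>: "sets \<mu> = sets (sequence_borel (A 0) (level_subshift A \<tau> 0))"
    and mp: "measure_preserving \<mu> seq_shift"
begin

interpretation measure_preserving \<mu> seq_shift by (rule mp)

lemma tower_level_sets' [measurable]: "tower_level A \<tau> n a k \<in> sets \<mu>"
  using tower_level_sets[OF D] by (simp add: sets_\<mu>)

text \<open>Recognizability makes the floors disjoint, and invariance with injectivity of the shift
  gives them equal measure.\<close>

lemma measure_tower: "prob (tower A \<tau> n a) = real (tower_height \<tau> n a) * prob (tower_level A \<tau> n a 0)"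
proof -
  have eq: "prob (tower_level A \<tau> n a k) = prob (tower_level A \<tau> n a 0)" for k
    using measure_image_funpow_T[OF inj_seq_shift, of "tower_level A \<tau> n a 0" k]
      sets.sets_into_space[OF tower_level_sets'[of n a 0]] tower_level_sets'[of n a k]
    by (simp add: tower_level_funpow)
  have "prob (tower A \<tau> n a) = (\<Sum>k<tower_height \<tau> n a. prob (tower_level A \<tau> n a k))"
    unfolding tower_eq
  proof (rule finite_measure_finite_Union)
    show "disjoint_family_on (tower_level A \<tau> n a) {..<tower_height \<tau> n a}"
      unfolding disjoint_family_on_def using tower_level_disjoint[OF D R, of _ n a _ a] by blast
  qed auto
  also have "\<dots> = (\<Sum>k<tower_height \<tau> n a. prob (tower_level A \<tau> n a 0))"
    by (intro sum.cong refl eq)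
  finally show ?thesis by simp
qed

context
  fixes S :: "'a set" and n :: nat
  assumes S: "S \<subseteq> A n"
begin

lemma finite_S: "finite S"
  using S directive_sequenceD(1)[OF D] finite_subset by blast

lemma tower_bases_sets [measurable]: "tower_bases A \<tau> n S \<in> sets \<mu>"
  unfolding tower_bases_def using finite_S by auto

lemma base_nearly_constant:
  fixes f g :: "(int \<Rightarrow> 'a) \<Rightarrow> complex" and z :: complex
  assumes f_int: "integrable \<mu> f" and z: "norm z = 1"
    and eigen: "AE x in \<mu>. f (seq_shift x) = z * f x"
    and g: "integrable \<mu> g"
    and g_local: "\<forall>x\<in>level_subshift A \<tau> 0. \<forall>y\<in>level_subshift A \<tau> 0. agree (int m) x y \<longrightarrow> g x = g y"
    and u: "\<And>a. a \<in> S \<Longrightarrow> d \<le> tower_height \<tau> n a"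
      "\<And>a. a \<in> S \<Longrightarrow> segment (comp_morph \<tau> 0 n a) c d = u"
    and large: "2 * m < d - c"
  shows "\<exists>w. (real (d - c) - 2 * real m) * (\<integral>x. indicator (tower_bases A \<tau> n S) x * norm (f x - w) \<partial>\<mu>)
    \<le> (\<integral>x. norm (f x - g x) \<partial>\<mu>)"
proof -
  \<comment> \<open>Trimming \<open>m\<close> positions at both ends keeps the window of radius
    \<open>m\<close> around floor \<open>j\<close> inside the stretch where every base point reads
    \<open>u\<close>.\<close>
  let ?J = "{c + m..<d - m}"
  have image: "(seq_shift ^^ j) ` (tower_bases A \<tau> n S) = (\<Union>b\<in>S. tower_level A \<tau> n b j)" for j
    unfolding tower_bases_def image_UN by (simp add: tower_level_funpow)
  have word: "x (int k) = u ! (k - c)" if x: "x \<in> tower_bases A \<tau> n S" and k: "c \<le> k" "k < d" for x k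
  proof -
    obtain b where b: "b \<in> S" "x \<in> tower_level A \<tau> n b 0"
      using x by (auto simp: tower_bases_def)
    have "k < tower_height \<tau> n b"
      using k u(1)[OF b(1)] by simp
    from tower_level_word[OF D b(2) this] show ?thesis
      using nth_segment[OF k, of "comp_morph \<tau> 0 n b"] u[OF b(1)] by (simp add: tower_height_def)
  qed
  have g_eq: "g ((seq_shift ^^ j) x) = g ((seq_shift ^^ j) y)" if j: "j \<in> ?J" and x: "x \<in> tower_bases A \<tau> n S" and y: "y \<in> tower_bases A \<tau> n S" for j x y
  proof -
    have "x (i + int j) = y (i + int j)" if "\<bar>i\<bar> \<le> int m" for i
    proof -
      have "i + int j = int (nat (i + int j))" "c \<le> nat (i + int j)" "nat (i + int j) < d"
        using j that by auto
      then show ?thesis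
        using word[OF x] word[OF y] by metis
    qed
    moreover have "(seq_shift ^^ j) x \<in> level_subshift A \<tau> 0" if "x \<in> tower_bases A \<tau> n S" for x
      using that image[of j] tower_level_subset[OF D] by blast
    ultimately show ?thesis
      using g_local x y by (simp add: agree_def seq_shift_funpow)
  qed
  have "\<exists>w. real (card ?J) * (\<integral>x. indicator (tower_bases A \<tau> n S) x * norm (f x - w) \<partial>\<mu>) \<le> (\<integral>x. norm (f x - g x) \<partial>\<mu>)"
  proof (rule eigenfunction_nearly_constant[OF f_int z eigen inj_seq_shift g tower_bases_sets])
    show "disjoint_family_on (\<lambda>j. (seq_shift ^^ j) ` (tower_bases A \<tau> n S)) ?J"
      unfolding disjoint_family_on_def
    proof (intro ballI impI)
      fix i j assume ij: "i \<in> ?J" "j \<in> ?J" "i \<noteq> j"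
      have False if "y \<in> (seq_shift ^^ i) ` (tower_bases A \<tau> n S)" "y \<in> (seq_shift ^^ j) ` (tower_bases A \<tau> n S)" for y
      proof -
        from that obtain a b where ab: "a \<in> S" "b \<in> S" "y \<in> tower_level A \<tau> n a i" "y \<in> tower_level A \<tau> n b j"
          unfolding image by blast
        have "i < tower_height \<tau> n a" "j < tower_height \<tau> n b"
          using ij u(1)[OF ab(1)] u(1)[OF ab(2)] by auto
        from tower_level_disjoint[OF D R this ab(3,4)] ij(3) show False by simp
      qed
      then show "(seq_shift ^^ i) ` (tower_bases A \<tau> n S) \<inter> (seq_shift ^^ j) ` (tower_bases A \<tau> n S) = {}" by blast
    qed
    show "(seq_shift ^^ j) ` (tower_bases A \<tau> n S) \<in> sets \<mu>" for j
      unfolding image using finite_S by auto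
    \<comment> \<open>Any base point may represent the common value on floor \<open>j\<close>; for
      an empty base the claim is vacuous.\<close>
    show "g ((seq_shift ^^ j) x) = g ((seq_shift ^^ j) (SOME y. y \<in> tower_bases A \<tau> n S))" if "j \<in> ?J" "x \<in> tower_bases A \<tau> n S" for j x
      using g_eq[OF that(1,2) someI[of "\<lambda>y. y \<in> tower_bases A \<tau> n S", OF that(2)]] .
  qed (use large in auto)
  moreover have "real (card ?J) = real (d - c) - 2 * real m"
    using large by simp
  ultimately show ?thesis by simp
qed

text \<open>Points of the base over \<open>a\<close> that miss \<open>tower_bases\<close> land in
  the base of a tower outside \<open>S\<close>. By invariance they weigh at most as much as those
  bases, each of which has at most 1/H of its tower. Multiplying by \<open>K * H\<close>, a bound
  for the height of \<open>a\<close>, turns base measures into tower measures.\<close>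

lemma return_measure:
  assumes a: "a \<in> S" and K: "\<And>b. b \<in> A n \<Longrightarrow> real (tower_height \<tau> n b) \<le> K * H"
    and H: "H > 0" "\<And>b. b \<in> A n \<Longrightarrow> H \<le> real (tower_height \<tau> n b)" and "K > 0"
  shows "prob (tower A \<tau> n a) - K * (\<Sum>b\<in>A n - S. prob (tower A \<tau> n b)) \<le>
    K * H * prob {x \<in> tower_level A \<tau> n a 0. (seq_shift ^^ tower_height \<tau> n a) x \<in> tower_bases A \<tau> n S}"
    (is "_ \<le> _ * prob ?C")
proof -
  let ?h = "tower_height \<tau> n a" and ?B = "tower_level A \<tau> n a 0"
  let ?U = "\<Union>b\<in>A n - S. tower_level A \<tau> n b 0"
  have fin: "finite (A n - S)"
    using directive_sequenceD(1)[OF D] by blast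
  have U [measurable]: "?U \<in> sets \<mu>" using fin by auto
  let ?V = "(seq_shift ^^ ?h) -` ?U \<inter> space \<mu>"
  have V: "?V \<in> sets \<mu>"
    by (rule measurable_sets[OF measurable_funpow_T U])
  have "?C = ?B \<inter> ((seq_shift ^^ ?h) -` (tower_bases A \<tau> n S) \<inter> space \<mu>)"
    using sets.sets_into_space[OF tower_level_sets'[of n a 0]] by auto
  then have C: "?C \<in> sets \<mu>"
    using measurable_sets[OF measurable_funpow_T tower_bases_sets, of ?h] by auto
  have "?B \<subseteq> ?C \<union> ?V"
  proof
    fix x assume x: "x \<in> ?B"
    from tower_level_return[OF D this] obtain b
      where "b \<in> A n" "(seq_shift ^^ ?h) x \<in> tower_level A \<tau> n b 0" by blast
    then show "x \<in> ?C \<union> ?V"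
      using x sets.sets_into_space[OF tower_level_sets'[of n a 0]] by (auto simp: tower_bases_def)
  qed
  then have "prob ?B \<le> prob (?C \<union> ?V)"
    using C V by (intro finite_measure_mono) auto
  also have "\<dots> \<le> prob ?C + prob ?V"
    using C V by (intro measure_Un_le) auto
  also have "prob ?V = prob ?U"
    using measure_distr[OF measurable_funpow_T[of ?h] U] by (simp add: distr_funpow_T)
  also have "prob ?U \<le> (\<Sum>b\<in>A n - S. prob (tower_level A \<tau> n b 0))"
    using fin by (intro finite_measure_subadditive_finite) auto
  finally have *: "prob ?B \<le> prob ?C + (\<Sum>b\<in>A n - S. prob (tower_level A \<tau> n b 0))" by simp
  have "H * prob (tower_level A \<tau> n b 0) \<le> prob (tower A \<tau> n b)" if "b \<in> A n" for b
    unfolding measure_tower using H(2)[OF that] by (intro mult_right_mono) auto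
  then have **: "H * (\<Sum>b\<in>A n - S. prob (tower_level A \<tau> n b 0)) \<le> (\<Sum>b\<in>A n - S. prob (tower A \<tau> n b))"
    unfolding sum_distrib_left by (intro sum_mono) auto
  have "prob (tower A \<tau> n a) \<le> K * H * prob ?B"
    unfolding measure_tower using K[of a] a S by (intro mult_right_mono) auto
  also have "\<dots> \<le> K * H * (prob ?C + (\<Sum>b\<in>A n - S. prob (tower_level A \<tau> n b 0)))"
    using * H(1) \<open>K > 0\<close> by (intro mult_left_mono) auto
  also have "\<dots> = K * H * prob ?C + K * (H * (\<Sum>b\<in>A n - S. prob (tower_level A \<tau> n b 0)))"
    by (simp add: algebra_simps)
  also have "\<dots> \<le> K * H * prob ?C + K * (\<Sum>b\<in>A n - S. prob (tower A \<tau> n b))"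
    using ** \<open>K > 0\<close> by (intro add_left_mono mult_left_mono) auto
  finally show ?thesis by simp
qed

end

end

theorem proposition5p1:
  fixes A :: "nat \<Rightarrow> 'a set"
    and \<tau> :: "nat \<Rightarrow> 'a \<Rightarrow> 'a list"
    and \<mu> :: "(int \<Rightarrow> 'a) measure"
    and A\<mu> :: "'a set"
    and z :: complex
    and \<alpha> :: real
  assumes "directive_sequence A \<tau>"
    and "primitive A \<tau>" and "proper A \<tau>" and "recognizable A \<tau>"
    and "sets \<mu> = sets (sequence_borel (A 0) (level_subshift A \<tau> 0))"
    and "ergodic_invariant_prob \<mu> seq_shift"
    and "clean A \<tau> \<mu> A\<mu>"
    and "\<exists>K>0. \<forall>\<^sub>F n in sequentially.
           real (max_length (A n) (comp_morph \<tau> 0 n)) / real (min_length (A n) (comp_morph \<tau> 0 n)) \<le> K"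
    and "\<exists>\<delta>>0. \<forall>\<^sub>F n in sequentially. \<exists>u c d.
           u \<noteq> [] \<and> set u \<subseteq> A 0 \<and>
           c < d \<and> d \<le> min_length A\<mu> (comp_morph \<tau> 0 n) \<and>
           real (length u) \<ge> \<delta> * real (min_length A\<mu> (comp_morph \<tau> 0 n)) \<and>
           (\<forall>a\<in>A\<mu>. segment (comp_morph \<tau> 0 n a) c d = u)"
    and "measurable_eigenvalue \<mu> seq_shift z"
    and "z = exp (2 * complex_of_real pi * \<i> * complex_of_real \<alpha>)"
  shows "\<forall>a\<in>A\<mu>. (\<lambda>n. infdist (\<alpha> * real (tower_height \<tau> n a)) \<int>) \<longlonglongrightarrow> 0"
proof
  note D = \<open>directive_sequence A \<tau>\<close> and R = \<open>recognizable A \<tau>\<close>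
    and sets_\<mu> = \<open>sets \<mu> = sets (sequence_borel (A 0) (level_subshift A \<tau> 0))\<close>
  note fin = directive_sequenceD(1)[OF D]
  fix a assume a: "a \<in> A\<mu>"
  have "prob_space \<mu>" "seq_shift \<in> measurable \<mu> \<mu>" "distr \<mu> \<mu> seq_shift = \<mu>"
    and ergodic: "\<And>B. B \<in> sets \<mu> \<Longrightarrow> seq_shift -` B \<inter> space \<mu> = B \<Longrightarrow> measure \<mu> B = 0 \<or> measure \<mu> B = 1"
    using \<open>ergodic_invariant_prob \<mu> seq_shift\<close> by (auto simp: ergodic_invariant_prob_def)
  then have mp: "measure_preserving \<mu> seq_shift"
    by (simp add: measure_preserving_def measure_preserving_axioms_def)
  interpret measure_preserving \<mu> seq_shift by (rule mp)
  have X: "level_subshift A \<tau> 0 \<subseteq> {x. \<forall>i. x i \<in> A 0}"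
    by (auto intro: level_subshift_letter)
  have "space \<mu> = level_subshift A \<tau> 0"
    by (rule space_eq_sequences[OF X sets_\<mu> finite_measure_axioms])
  \<comment> \<open>Arbitrarily long windows of this point force tall towers.\<close>
  then obtain x where x: "x \<in> level_subshift A \<tau> 0"
    using not_empty by auto
  obtain f where f: "f \<in> borel_measurable \<mu>" "integrable \<mu> (\<lambda>x. (norm (f x))\<^sup>2)"
      "\<not> (AE x in \<mu>. f x = 0)" and eigen: "AE x in \<mu>. f (seq_shift x) = z * f x"
    using \<open>measurable_eigenvalue \<mu> seq_shift z\<close> by (auto simp: measurable_eigenvalue_def)
  \<comment> \<open>On a probability space L2 lies in L1, here by the bound |f| \<le> 1 +
    |f|^2.\<close>
  have f_int: "integrable \<mu> f"
  proof (rule Bochner_Integration.integrable_bound)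
    show "integrable \<mu> (\<lambda>x. 1 + (norm (f x))\<^sup>2)" using f(2) by auto
    show "AE x in \<mu>. norm (f x) \<le> norm (1 + (norm (f x))\<^sup>2)"
    proof (rule AE_I2)
      fix x
      have "0 \<le> (norm (f x) - 1)\<^sup>2 + (norm (f x))\<^sup>2 + 1" by simp
      then have "norm (f x) \<le> 1 + (norm (f x))\<^sup>2"
        by (simp add: power2_diff)
      then show "norm (f x) \<le> norm (1 + (norm (f x))\<^sup>2)" by simp
    qed
  qed (rule f(1))
  have z: "norm z = 1"
    using \<open>z = exp _\<close> by simp
  obtain r where r: "r > 0" "AE x in \<mu>. r \<le> norm (f x)"
    using eigenfunction_bounded_below[OF f_int z eigen ergodic f(3)] .
  obtain n\<^sub>0 \<kappa> where n\<^sub>0: "\<And>n. n \<ge> n\<^sub>0 \<Longrightarrow> A n = A n\<^sub>0" "A\<mu> \<subseteq> A n\<^sub>0"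
    and \<kappa>: "\<kappa> > 0" "\<And>n a. n \<ge> n\<^sub>0 \<Longrightarrow> a \<in> A\<mu> \<Longrightarrow> \<kappa> \<le> prob (tower A \<tau> n a)"
    and null: "\<And>b. b \<in> A n\<^sub>0 - A\<mu> \<Longrightarrow> (\<lambda>n. prob (tower A \<tau> n b)) \<longlonglongrightarrow> 0"
    using \<open>clean A \<tau> \<mu> A\<mu>\<close> unfolding clean_def by blast
  obtain K where K: "K > 0" and ratio: "\<forall>\<^sub>F n in sequentially.
      real (max_length (A n) (comp_morph \<tau> 0 n)) / real (min_length (A n) (comp_morph \<tau> 0 n)) \<le> K"
    using assms(8) by blast
  obtain \<delta> where \<delta>: "\<delta> > 0" and common: "\<forall>\<^sub>F n in sequentially. \<exists>u c d.
           u \<noteq> [] \<and> set u \<subseteq> A 0 \<and>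
           c < d \<and> d \<le> min_length A\<mu> (comp_morph \<tau> 0 n) \<and>
           real (length u) \<ge> \<delta> * real (min_length A\<mu> (comp_morph \<tau> 0 n)) \<and>
           (\<forall>a\<in>A\<mu>. segment (comp_morph \<tau> 0 n a) c d = u)"
    using assms(9) by blast
  let ?H = "\<lambda>n. real (min_length (A n) (comp_morph \<tau> 0 n))"
  note H_top = min_tower_height_at_top[OF D x ratio]
  have bound: "\<forall>\<^sub>F n in sequentially. norm (z ^ tower_height \<tau> n a - 1) \<le> e" if "e > 0" for e
  proof -
    \<comment> \<open>Fitted to the final chain, which bounds |z^h - 1| * \<delta> * r * \<kappa> /
      2 by 4 * K * \<epsilon>.\<close>
    define \<epsilon> where "\<epsilon> = e * \<delta> * r * \<kappa> / (8 * K)"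
    have "\<epsilon> > 0" using \<open>e > 0\<close> \<delta> r \<kappa> K by (simp add: \<epsilon>_def)
    then obtain m' g where g: "integrable \<mu> g"
        "\<forall>x\<in>level_subshift A \<tau> 0. \<forall>y\<in>level_subshift A \<tau> 0. agree m' x y \<longrightarrow> g x = g y"
        "(\<integral>x. norm (f x - g x) \<partial>\<mu>) < \<epsilon>"
      using cylinder_function_approx[OF X sets_\<mu> finite_measure_axioms f_int] by blast
    define m where "m = nat \<bar>m'\<bar>"
    have g_local: "\<forall>x\<in>level_subshift A \<tau> 0. \<forall>y\<in>level_subshift A \<tau> 0. agree (int m) x y \<longrightarrow> g x = g y"
    proof (intro ballI impI)
      fix x y
      assume "x \<in> level_subshift A \<tau> 0" "y \<in> level_subshift A \<tau> 0" "agree (int m) x y"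
      moreover from this(3) have "agree m' x y"
        by (rule agree_mono) (simp add: m_def)
      ultimately show "g x = g y" using g(2) by blast
    qed
    \<comment> \<open>The alphabet is eventually fixed, so this is a finite sum of null sequences.
      The threshold \<kappa>/(2K) costs half of \<kappa> in \<open>return_measure\<close>.\<close>
    have "(\<lambda>n. \<Sum>b\<in>A n\<^sub>0 - A\<mu>. prob (tower A \<tau> n b)) \<longlonglongrightarrow> (\<Sum>b\<in>A n\<^sub>0 - A\<mu>. 0)"
      by (intro tendsto_sum null)
    then have "\<forall>\<^sub>F n in sequentially. (\<Sum>b\<in>A n\<^sub>0 - A\<mu>. prob (tower A \<tau> n b)) < \<kappa> / (2 * K)"
      using \<kappa>(1) K by (intro order_tendstoD) auto
    \<comment> \<open>Makes the common word at least 4(m + 1) long, so trimming 2m floors loses at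
      most half of them.\<close>
    moreover have "\<forall>\<^sub>F n in sequentially. 4 * (real m + 1) / \<delta> \<le> ?H n"
      using H_top unfolding filterlim_at_top by (rule spec)
    ultimately show ?thesis
      using ratio common eventually_ge_at_top[of n\<^sub>0]
    proof eventually_elim
      case (elim n)
      define H where "H = ?H n"
      define h where "h = tower_height \<tau> n a"
      have S: "A\<mu> \<subseteq> A n" using n\<^sub>0(1)[OF elim(5)] n\<^sub>0(2) by simp
      have fin_S: "finite A\<mu>" using S fin by (rule finite_subset)
      have \<delta>H: "4 * (real m + 1) \<le> \<delta> * H"
        using elim(2) \<delta> by (simp add: H_def pos_divide_le_eq mult.commute)
      then have "\<delta> * H > 0" by (rule less_le_trans[rotated]) simp
      then have H: "H > 0" using \<delta> by (simp add: zero_less_mult_iff)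
      have H_le: "H \<le> real (tower_height \<tau> n b)" if "b \<in> A n" for b
        using min_length_le[OF fin that] by (simp add: H_def tower_height_def)
      have le_KH: "real (tower_height \<tau> n b) \<le> K * H" if "b \<in> A n" for b
      proof -
        have "real (tower_height \<tau> n b) \<le> real (max_length (A n) (comp_morph \<tau> 0 n))"
          using max_length_ge[OF fin that] by (simp add: tower_height_def)
        also have "\<dots> \<le> K * H"
          using elim(3) H by (simp add: H_def pos_divide_le_eq)
        finally show ?thesis .
      qed
      obtain u c d where u: "d \<le> min_length A\<mu> (comp_morph \<tau> 0 n)"
          "real (length u) \<ge> \<delta> * real (min_length A\<mu> (comp_morph \<tau> 0 n))"
          "\<And>a. a \<in> A\<mu> \<Longrightarrow> segment (comp_morph \<tau> 0 n a) c d = u"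
        using elim(4) by blast
      have d_le: "d \<le> tower_height \<tau> n b" if "b \<in> A\<mu>" for b
        using u(1) min_length_le[OF fin_S that, of "comp_morph \<tau> 0 n"] by (simp add: tower_height_def)
      define l where "l = d - c"
      have len_u: "length u = l"
        using length_segment[of d "comp_morph \<tau> 0 n a" c] d_le[OF a] u(3)[OF a]
        by (simp add: tower_height_def l_def)
      \<comment> \<open>A minimum over the smaller set \<open>A\<mu>\<close>, nonempty because it
        contains \<open>a\<close>, so the bound on |u| holds with \<open>H\<close> as well.\<close>
      have "H \<le> real (min_length A\<mu> (comp_morph \<tau> 0 n))"
      proof -
        obtain b where "b \<in> A\<mu>" "min_length A\<mu> (comp_morph \<tau> 0 n) = length (comp_morph \<tau> 0 n b)"
          using min_length_attained[OF fin_S] a by blast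
        then show ?thesis
          using H_le[of b] S by (auto simp: tower_height_def)
      qed
      then have "\<delta> * H \<le> \<delta> * real (min_length A\<mu> (comp_morph \<tau> 0 n))"
        using \<delta> by (intro mult_left_mono) auto
      then have \<delta>H_le: "\<delta> * H \<le> real l"
        using u(2) len_u by simp
      have ml: "4 * (real m + 1) \<le> real l"
        by (rule order_trans[OF \<delta>H \<delta>H_le])
      then have "real (2 * m) < real l"
        using of_nat_0_le_iff[of m, where 'a = real] by simp
      then have "2 * m < d - c" by (simp add: l_def)
      then obtain w where w: "(real l - 2 * real m) *
          (\<integral>x. indicator (tower_bases A \<tau> n A\<mu>) x * norm (f x - w) \<partial>\<mu>) \<le> (\<integral>x. norm (f x - g x) \<partial>\<mu>)"
        using base_nearly_constant[OF D R sets_\<mu> mp S f_int z eigen g(1) g_local d_le u(3)]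
        unfolding l_def by blast
      define I where "I = (\<integral>x. indicator (tower_bases A \<tau> n A\<mu>) x * norm (f x - w) \<partial>\<mu>)"
      define C where "C = {x \<in> tower_level A \<tau> n a 0. (seq_shift ^^ h) x \<in> tower_bases A \<tau> n A\<mu>}"
      have "I \<ge> 0"
        unfolding I_def by (intro Bochner_Integration.integral_nonneg) auto
      \<comment> \<open>From l \<ge> 4m and l \<ge> \<delta> * H: l - 2m \<ge> l/2 \<ge> \<delta> *
        H / 2.\<close>
      have "\<delta> * H / 2 * I \<le> (real l - 2 * real m) * I"
        using ml \<delta>H_le \<open>I \<ge> 0\<close> by (intro mult_right_mono) (simp_all add: algebra_simps)
      also have "\<dots> \<le> \<epsilon>" using w g(3) by (simp add: I_def)
      finally have I_le: "\<delta> * (H * I) \<le> 2 * \<epsilon>" by simp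
      have bases: "tower_bases A \<tau> n A\<mu> \<in> sets \<mu>"
        by (rule tower_bases_sets[OF D R sets_\<mu> mp S])
      have C: "C \<in> sets \<mu>"
      proof -
        have level: "tower_level A \<tau> n a 0 \<in> sets \<mu>"
          using tower_level_sets[OF D] by (simp add: sets_\<mu>)
        have "C = tower_level A \<tau> n a 0 \<inter> ((seq_shift ^^ h) -` tower_bases A \<tau> n A\<mu> \<inter> space \<mu>)"
          using sets.sets_into_space[OF level] by (auto simp: C_def)
        then show ?thesis
          using level measurable_sets[OF measurable_funpow_T bases] by auto
      qed
      have est: "norm (z ^ h - 1) * r * prob C \<le> 2 * I"
        unfolding I_def
        by (rule eigenvalue_return_time[OF f_int z eigen bases C _ _ r(2)])
          (use a in \<open>auto simp: C_def tower_bases_def\<close>)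
      have "\<kappa> / 2 \<le> K * H * prob C"
      proof -
        have "K * (\<Sum>b\<in>A n - A\<mu>. prob (tower A \<tau> n b)) \<le> \<kappa> / 2"
          using elim(1) n\<^sub>0(1)[OF elim(5)] K by (simp add: field_simps)
        moreover have "\<kappa> \<le> prob (tower A \<tau> n a)"
          by (rule \<kappa>(2)[OF elim(5) a])
        moreover have "prob (tower A \<tau> n a) - K * (\<Sum>b\<in>A n - A\<mu>. prob (tower A \<tau> n b)) \<le> K * H * prob C"
          unfolding C_def h_def by (rule return_measure[OF D R sets_\<mu> mp S a le_KH H H_le K])
        ultimately show ?thesis by linarith
      qed
      \<comment> \<open>The lower bound for \<open>C\<close> is of order 1/H and so is the upper
        bound for \<open>I\<close>; multiplied together below, they leave an estimate free of
        \<open>n\<close>.\<close>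
      then have "norm (z ^ h - 1) * r * (\<kappa> / 2) \<le> norm (z ^ h - 1) * r * (K * H * prob C)"
        using r(1) by (intro mult_left_mono) auto
      also have "\<dots> = K * H * (norm (z ^ h - 1) * r * prob C)" by (simp add: mult_ac)
      also have "\<dots> \<le> K * H * (2 * I)"
        using est K H by (intro mult_left_mono) auto
      finally have "\<delta> * (norm (z ^ h - 1) * r * (\<kappa> / 2)) \<le> \<delta> * (K * H * (2 * I))"
        using \<delta> by (intro mult_left_mono) auto
      also have "\<dots> = 2 * K * (\<delta> * (H * I))" by (simp add: mult_ac)
      also have "\<dots> \<le> 2 * K * (2 * \<epsilon>)"
        using I_le K by (intro mult_left_mono) auto
      also have "\<dots> = e * (\<delta> * r * (\<kappa> / 2))"
        using K by (simp add: \<epsilon>_def field_simps)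
      finally have "norm (z ^ h - 1) * (\<delta> * r * (\<kappa> / 2)) \<le> e * (\<delta> * r * (\<kappa> / 2))"
        by (simp add: mult_ac)
      then show "norm (z ^ tower_height \<tau> n a - 1) \<le> e"
        using \<delta> r(1) \<kappa>(1) by (simp add: h_def)
    qed
  qed
  have "(\<lambda>n. z ^ tower_height \<tau> n a) \<longlonglongrightarrow> 1"
    unfolding tendsto_iff dist_norm
  proof (intro allI impI)
    fix e :: real assume "e > 0"
    then have "\<forall>\<^sub>F n in sequentially. norm (z ^ tower_height \<tau> n a - 1) \<le> e / 2"
      by (intro bound) simp
    then show "\<forall>\<^sub>F n in sequentially. norm (z ^ tower_height \<tau> n a - 1) < e"
      by eventually_elim (use \<open>e > 0\<close> in simp)
  qed
  moreover have "z ^ tower_height \<tau> n a =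
      exp (2 * complex_of_real pi * \<i> * complex_of_real (\<alpha> * real (tower_height \<tau> n a)))" for n
    unfolding \<open>z = exp _\<close> by (simp add: mult_ac flip: exp_of_nat_mult)
  ultimately show "(\<lambda>n. infdist (\<alpha> * real (tower_height \<tau> n a)) \<int>) \<longlonglongrightarrow> 0"
    by (intro infdist_Ints_tendsto_0) simp
qed

end
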